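(* Let $G$ be an induced subgraph of an icosahedral thickening. Then $\chi(G)\leq \gamma_\ell(G)=\max_{v\in V(G)}\lceil\frac12(d(v)+1+\omega(v))\rceil$.
   Context: Let $G_0$ be the icosahedron with vertices $v_0,\dots,v_{11}$: for $1\le i\le 10$, $v_i$ is adjacent to $v_{i+1}$ and $v_{i+2}$ (indices modulo 10 in $\{1,\dots,10\}$); $N(v_0)=\{v_1,v_3,v_5,v_7,v_9\}$ and $N(v_{11})=\{v_2,v_4,v_6,v_8,v_{10}\}$. Let $G_1=G_0-v_{11}$ and $G_2=G_1-v_{10}$. A thickening of a graph $H$ under a matching $M\subseteq E(H)$: replace each vertex $v$ by a nonempty clique $I(v)$ (disjoint), with $I(u)$ complete to $I(v)$ if $uv\in E(H)$ and anticomplete otherwise, then for each $uv\in M$ remove a nonempty proper subset of the edges between $I(u)$ and $I(v)$; it is proper if $M=\emptyset$. An icosahedral thickening is a proper thickening of $G_0$ or $G_1$, or a thickening of $G_2\cup M$ under $M$ for some $M\subseteq\{v_1v_4,v_6v_9\}$ (where $G_2\cup M$ is $G_2$ with the pairs of $M$ added as edges). $d(v)$ is the degree and $\omega(v)$ the largest clique containing $v$. *)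

theory Defs
  imports Complex_Main "HOL-Library.Ramsey" "HOL-Library.Disjoint_Sets"
begin

section \<open>Finite simple graphs\<close>

text \<open>Edges are two-element sets of vertices, so that the predicate \<^const>\<open>clique\<close> of
  \<^theory>\<open>HOL-Library.Ramsey\<close> applies.\<close>

record 'a sgraph =
  verts :: "'a set"
  edges :: "'a set set"

definition simple_graph :: "'a sgraph \<Rightarrow> bool" where
  "simple_graph G \<longleftrightarrow> finite (verts G) \<and> edges G \<subseteq> [verts G]\<^bsup>2\<^esup>"

definition induced :: "'a sgraph \<Rightarrow> 'a set \<Rightarrow> 'a sgraph" where
  "induced G W = \<lparr> verts = W, edges = {e \<in> edges G. e \<subseteq> W} \<rparr>"

definition is_induced_subgraph :: "'a sgraph \<Rightarrow> 'a sgraph \<Rightarrow> bool" where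
  "is_induced_subgraph G H \<longleftrightarrow> (\<exists>W \<subseteq> verts H. G = induced H W)"

definition delete_vertex :: "'a sgraph \<Rightarrow> 'a \<Rightarrow> 'a sgraph" where
  "delete_vertex G v = induced G (verts G - {v})"

definition add_edges :: "'a sgraph \<Rightarrow> 'a set set \<Rightarrow> 'a sgraph" where
  "add_edges G M = \<lparr> verts = verts G, edges = edges G \<union> M \<rparr>"

definition vdegree :: "'a sgraph \<Rightarrow> 'a \<Rightarrow> nat" where
  "vdegree G v = card {u \<in> verts G. {u, v} \<in> edges G}"

definition vclique_number :: "'a sgraph \<Rightarrow> 'a \<Rightarrow> nat" where
  "vclique_number G v = Max (card ` {K. K \<subseteq> verts G \<and> clique K (edges G) \<and> v \<in> K})"

definition proper_colouring :: "'a sgraph \<Rightarrow> ('a \<Rightarrow> nat) \<Rightarrow> bool" where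
  "proper_colouring G c \<longleftrightarrow>
     (\<forall>u \<in> verts G. \<forall>v \<in> verts G. {u, v} \<in> edges G \<longrightarrow> c u \<noteq> c v)"

definition chromatic_number :: "'a sgraph \<Rightarrow> nat" where
  "chromatic_number G = (LEAST k. \<exists>c. proper_colouring G c \<and> c ` verts G \<subseteq> {..<k})"

definition vgamma_ell :: "'a sgraph \<Rightarrow> 'a \<Rightarrow> int" where
  "vgamma_ell G v = \<lceil>(real (vdegree G v) + 1 + real (vclique_number G v)) / 2\<rceil>"

text \<open>The maximum over the vertices.  All local values are at least 1, so inserting 0 matters
  only for the graph without vertices, where it is the usual value of the empty maximum.\<close>

definition gamma_ell :: "'a sgraph \<Rightarrow> int" where
  "gamma_ell G = Max (insert 0 (vgamma_ell G ` verts G))"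


section \<open>Thickenings\<close>

definition matching :: "'a sgraph \<Rightarrow> 'a set set \<Rightarrow> bool" where
  "matching H M \<longleftrightarrow> M \<subseteq> edges H \<and> disjoint M"

definition edges_between :: "'a set \<Rightarrow> 'a set \<Rightarrow> 'a set set" where
  "edges_between A B = {{a, b} | a b. a \<in> A \<and> b \<in> B}"

text \<open>\<open>I v\<close> is the clique replacing \<open>v\<close>, and \<open>R e\<close> is the set of edges removed for \<open>e \<in> M\<close>.
  The vertex types of \<open>H\<close> and \<open>G\<close> are independent, and any sets may be chosen as the \<open>I v\<close>, so
  the set of thickenings on a given type is closed under isomorphism.\<close>

definition thickening :: "'b sgraph \<Rightarrow> 'b set set \<Rightarrow> 'a sgraph \<Rightarrow> bool" where
  "thickening H M G \<longleftrightarrow> matching H M \<and>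
     (\<exists>(I :: 'b \<Rightarrow> 'a set) (R :: 'b set \<Rightarrow> 'a set set).
        (\<forall>v \<in> verts H. finite (I v) \<and> I v \<noteq> {}) \<and>
        disjoint_family_on I (verts H) \<and>
        (\<forall>u v. {u, v} \<in> M \<longrightarrow> R {u, v} \<noteq> {} \<and> R {u, v} \<subset> edges_between (I u) (I v)) \<and>
        verts G = (\<Union>v \<in> verts H. I v) \<and>
        edges G = ((\<Union>v \<in> verts H. [I v]\<^bsup>2\<^esup>) \<union>
                   \<Union>{edges_between (I u) (I v) | u v. {u, v} \<in> edges H})
                  - (\<Union>e \<in> M. R e))"

definition proper_thickening :: "'b sgraph \<Rightarrow> 'a sgraph \<Rightarrow> bool" where
  "proper_thickening H G \<longleftrightarrow> thickening H {} G"


section \<open>Icosahedral thickenings\<close>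

text \<open>The vertex \<open>v\<^sub>i\<close> is represented by the number \<open>i\<close>.  The index \<open>i + k\<close>, read modulo 10 in
  the range from 1 to 10:\<close>

definition cyc :: "nat \<Rightarrow> nat \<Rightarrow> nat" where
  "cyc i k = (i + k - 1) mod 10 + 1"

definition G0 :: "nat sgraph" where
  "G0 = \<lparr> verts = {0..11},
          edges = {{i, cyc i k} | i k. i \<in> {1..10} \<and> k \<in> {1, 2}}
                \<union> {{0, i} | i. i \<in> {1, 3, 5, 7, 9}}
                \<union> {{11, i} | i. i \<in> {2, 4, 6, 8, 10}} \<rparr>"

definition G1 :: "nat sgraph" where
  "G1 = delete_vertex G0 11"

definition G2 :: "nat sgraph" where
  "G2 = delete_vertex G1 10"

definition icosahedral_thickening :: "'a sgraph \<Rightarrow> bool" where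
  "icosahedral_thickening G \<longleftrightarrow>
     proper_thickening G0 G \<or> proper_thickening G1 G \<or>
     (\<exists>M \<subseteq> {{1, 4}, {6, 9}}. thickening (add_edges G2 M) M G)"

lemma thickening_simple_graph:
  assumes "simple_graph H" and "thickening H M G"
  shows "simple_graph G"
proof -
  obtain I where fin: "\<forall>v \<in> verts H. finite (I v)"
    and disj: "disjoint_family_on I (verts H)"
    and V: "verts G = (\<Union>v \<in> verts H. I v)"
    and E: "edges G \<subseteq> (\<Union>v \<in> verts H. [I v]\<^bsup>2\<^esup>) \<union>
              \<Union>{edges_between (I u) (I v) | u v. {u, v} \<in> edges H}"
    using assms(2) unfolding thickening_def
    by (elim conjE exE) (erule that[rotated]; simp)
  have "e \<in> [verts G]\<^bsup>2\<^esup>" if e: "e \<in> edges G" for e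
  proof (cases "e \<in> (\<Union>v \<in> verts H. [I v]\<^bsup>2\<^esup>)")
    case True
    then show ?thesis using V by (auto simp: nsets_def)
  next
    case False
    then obtain u v where uv: "{u, v} \<in> edges H" "e \<in> edges_between (I u) (I v)"
      using subsetD[OF E e] by auto
    then have H: "u \<in> verts H" "v \<in> verts H" "u \<noteq> v"
      using assms(1) by (auto simp: simple_graph_def nsets_def)
    obtain a b where ab: "e = {a, b}" "a \<in> I u" "b \<in> I v"
      using uv by (auto simp: edges_between_def)
    then have "a \<noteq> b" using H disj by (auto simp: disjoint_family_on_def)
    then show ?thesis using ab H V by (auto simp: nsets_def)
  qed
  then show ?thesis
    using assms(1) fin V by (auto simp: simple_graph_def)
qed

end

theory Submission
  imports Defs "HOL-Library.Multiset"
begin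

text \<open>Colouring a blow-up of a fixed graph is a weighted problem: cover every base vertex \<open>v\<close>, with
  weight \<open>w v\<close> the size of its clique, exactly \<open>w v\<close> times by \<open>k\<close> stable sets.  The bound on
  \<open>\<gamma>\<^sub>\<ell>\<close> says that \<open>w(N[v]) + w(K) \<le> 2k\<close> for every base vertex \<open>v\<close> of positive weight and every
  maximal clique \<open>K\<close> containing \<open>v\<close>.  In a counterexample of minimal total weight every such \<open>v\<close> has
  \<open>w(N[v]) > k\<close>, since otherwise one unit of \<open>v\<close> can be coloured last, and removing \<open>t\<close> stable sets
  never lowers the bound by \<open>t\<close>.  For a few short lists of stable sets these conditions are
  contradictory linear inequalities.

  For the icosahedron, symmetry leaves four patterns of vanishing weights.  For a thickening
  under a matching, Koenig's theorem yields a minimum cover of the non-edges between the two cliques of a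
  matched pair.  Deleting all edges at the cover between the two cliques gives a blow-up of a graph on 14
  vertices.  A colouring of it can be rearranged inside the two cliques, because at most as many
  colours are shared by them as there are disjoint non-edges.\<close>

section \<open>Weighted colourings\<close>

text \<open>\<open>c i\<close> is the class of colour \<open>i\<close>, so \<open>w v\<close> counts
  the colours that \<open>v\<close> receives. The stability condition includes \<open>u = v\<close>,
  hence a vertex with a loop lies in no class.\<close>

definition multicolourable :: "('b \<Rightarrow> 'b \<Rightarrow> bool) \<Rightarrow> 'b set \<Rightarrow> nat \<Rightarrow> ('b \<Rightarrow> nat) \<Rightarrow> bool" where
  "multicolourable E B k w \<longleftrightarrow> (\<exists>c :: nat \<Rightarrow> 'b set. (\<forall>i<k. c i \<subseteq> B \<and> (\<forall>u\<in>c i. \<forall>v\<in>c i. \<not> E u v))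
     \<and> (\<forall>v\<in>B. card {i. i < k \<and> v \<in> c i} = w v))"

lemma multicolourable_zero: "(\<And>v. v \<in> B \<Longrightarrow> w v = 0) \<Longrightarrow> multicolourable E B k w"
  unfolding multicolourable_def by (rule exI[of _ "\<lambda>_. {}"]) auto

lemma multicolourable_Suc:
  assumes "multicolourable E B k (\<lambda>v. w v - of_bool (v \<in> S))" and S: "S \<subseteq> B" "\<And>u v. u \<in> S \<Longrightarrow> v \<in> S \<Longrightarrow> \<not> E u v"
    and w: "\<And>v. v \<in> S \<Longrightarrow> 0 < w v"
  shows "multicolourable E B (Suc k) w"
proof -
  obtain c where c: "\<forall>i<k. c i \<subseteq> B \<and> (\<forall>u\<in>c i. \<forall>v\<in>c i. \<not> E u v)"
    and card: "\<forall>v\<in>B. card {i. i < k \<and> v \<in> c i} = w v - of_bool (v \<in> S)"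
    using assms(1) unfolding multicolourable_def by blast
  have eq: "{i. i < Suc k \<and> v \<in> (c(k := S)) i} = (if v \<in> S then insert k else id) {i. i < k \<and> v \<in> c i}" for v
    by (auto simp: less_Suc_eq)
  have "card {i. i < Suc k \<and> v \<in> (c(k := S)) i} = w v" if "v \<in> B" for v
    using card that w[of v] unfolding eq by (auto simp: card_insert_if)
  then show ?thesis
    unfolding multicolourable_def by (intro exI[of _ "c(k := S)"]) (use c S in \<open>auto simp: less_Suc_eq\<close>)
qed

text \<open>Without one unit of \<open>v\<close>, the closed neighbourhood of \<open>v\<close>
  carries fewer than \<open>k\<close> units, so some class avoids it entirely and can take
  \<open>v\<close>.\<close>

lemma multicolourable_greedy:
  assumes "finite B" and v: "v \<in> B" "0 < w v" and sym: "\<And>u. u \<in> B \<Longrightarrow> E u v \<Longrightarrow> E v u" "\<not> E v v"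
    and le: "sum w {u \<in> B. u = v \<or> E v u} \<le> k" and "multicolourable E B k (w(v := w v - 1))"
  shows "multicolourable E B k w"
proof -
  let ?w = "w(v := w v - 1)" and ?N = "{u \<in> B. u = v \<or> E v u}"
  obtain c where c: "\<forall>i<k. c i \<subseteq> B \<and> (\<forall>u\<in>c i. \<forall>v\<in>c i. \<not> E u v)"
    and card: "\<forall>u\<in>B. card {i. i < k \<and> u \<in> c i} = ?w u"
    using assms(7) unfolding multicolourable_def by blast
  have "card (\<Union>u\<in>?N. {i. i < k \<and> u \<in> c i}) \<le> (\<Sum>u\<in>?N. card {i. i < k \<and> u \<in> c i})"
    using \<open>finite B\<close> by (intro card_UN_le) simp
  also have "\<dots> = sum ?w ?N" using card by simp
  also have "\<dots> < sum w ?N"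
    by (rule sum_strict_mono_ex1) (use \<open>finite B\<close> v in auto)
  finally have "card (\<Union>u\<in>?N. {i. i < k \<and> u \<in> c i}) < card {..<k}" using le by simp
  then have "\<not> {..<k} \<subseteq> (\<Union>u\<in>?N. {i. i < k \<and> u \<in> c i})"
    using card_mono[of "\<Union>u\<in>?N. {i. i < k \<and> u \<in> c i}" "{..<k}"] \<open>finite B\<close> by fastforce
  then obtain j where j: "j < k" "\<And>u. u \<in> ?N \<Longrightarrow> u \<notin> c j" by blast
  define d where "d = c(j := insert v (c j))"
  have eq: "{i. i < k \<and> u \<in> d i} = (if u = v then insert j else id) {i. i < k \<and> u \<in> c i}" for u
    using j(1) by (auto simp: d_def)
  have "card {i. i < k \<and> u \<in> d i} = w u" if "u \<in> B" for u
    using card that v j unfolding eq by (auto simp: card_insert_if)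
  moreover have "\<not> E a b" if "i < k" "a \<in> d i" "b \<in> d i" for i a b
  proof
    assume ab: "E a b"
    have ci: "a \<notin> c i \<or> b \<notin> c i" using c ab that(1) by blast
    then have [simp]: "i = j" using that by (auto simp: d_def split: if_splits)
    have "a = v \<or> b = v" "a \<noteq> v \<or> b \<noteq> v" using that ci ab sym(2) by (auto simp: d_def)
    have B: "x \<in> B" if "x \<in> c j" for x using that c j(1) by blast
    have N: "\<not> E v x" if "x \<in> c j" for x using j(2)[of x] B[OF that] that by blast
    have abj: "a \<in> insert v (c j)" "b \<in> insert v (c j)" using that by (simp_all add: d_def)
    consider "a = v" "b \<in> c j" | "b = v" "a \<in> c j"
      using abj \<open>a = v \<or> b = v\<close> \<open>a \<noteq> v \<or> b \<noteq> v\<close> by blast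
    then show False
    proof cases
      case 1
      then show False using ab N by blast
    next
      case 2
      then show False using ab N[of a] B[of a] sym(1)[of a] by blast
    qed
  qed
  ultimately show ?thesis
    unfolding multicolourable_def by (intro exI[of _ d]) (use c v in \<open>auto simp: d_def\<close>)
qed

text \<open>Used to share out the colours of one vertex among the vertices that are mapped to
  it.\<close>

lemma ex_disjoint_subsets:
  assumes "finite F" "finite T" "sum w F \<le> card T"
  shows "\<exists>D. (\<forall>u\<in>F. D u \<subseteq> T \<and> card (D u) = w u) \<and> disjoint_family_on D F"
  using assms
proof (induction F arbitrary: T rule: finite_induct)
  case empty
  then show ?case by (simp add: disjoint_family_on_def)
next
  case (insert x F)
  have "w x \<le> card T" using insert by simp
  then obtain X where X: "X \<subseteq> T" "card X = w x" "finite X"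
    by (rule obtain_subset_with_card_n)
  have "sum w F \<le> card (T - X)"
    using X insert by (subst card_Diff_subset) auto
  then obtain D where D: "\<forall>u\<in>F. D u \<subseteq> T - X \<and> card (D u) = w u" "disjoint_family_on D F"
    using insert.IH[of "T - X"] insert.prems(1) by auto
  have "disjoint_family_on (D(x := X)) (insert x F)"
    unfolding disjoint_family_on_def
  proof (intro ballI impI)
    fix a b assume ab: "a \<in> insert x F" "b \<in> insert x F" "a \<noteq> b"
    then consider "a = x" "b \<in> F" | "b = x" "a \<in> F" | "a \<in> F" "b \<in> F" "a \<noteq> x" "b \<noteq> x"
      using insert.hyps(2) by blast
    then show "(D(x := X)) a \<inter> (D(x := X)) b = {}"
    proof cases
      case 3
      then show ?thesis using D(2) ab(3) by (simp add: disjoint_family_on_def)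
    qed (use D(1) ab(3) in auto)
  qed
  moreover have "\<forall>u\<in>insert x F. (D(x := X)) u \<subseteq> T \<and> card ((D(x := X)) u) = w u"
    using D(1) X insert.hyps(2) by auto
  ultimately show ?case by blast
qed

text \<open>A colouring is pulled back along \<open>p\<close>: the colours of \<open>i\<close> are
  shared out disjointly within the fibre of \<open>i\<close>. An edge of \<open>E\<close> inside a
  fibre sees disjoint colour sets; any other edge lies over an edge of \<open>E'\<close>, whose ends
  have no common class. Automorphisms, mergings of vertices and blow-ups are all instances.\<close>

lemma multicolourable_transfer:
  assumes "finite B" "multicolourable E' B' k w'" and p: "\<And>u. u \<in> B \<Longrightarrow> 0 < w u \<Longrightarrow> p u \<in> B'"
    and le: "\<And>i. i \<in> B' \<Longrightarrow> sum w {u \<in> B. p u = i} \<le> w' i"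
    and E: "\<And>u v. u \<in> B \<Longrightarrow> v \<in> B \<Longrightarrow> 0 < w u \<Longrightarrow> 0 < w v \<Longrightarrow> E u v \<Longrightarrow> u \<noteq> v \<and> (p u = p v \<or> E' (p u) (p v))"
  shows "multicolourable E B k w"
proof -
  obtain c where c: "\<forall>i<k. c i \<subseteq> B' \<and> (\<forall>u\<in>c i. \<forall>v\<in>c i. \<not> E' u v)"
    and card: "\<forall>i\<in>B'. card {j. j < k \<and> i \<in> c j} = w' i"
    using assms(2) unfolding multicolourable_def by blast
  have "\<exists>D. \<forall>i\<in>B'. (\<forall>u\<in>{u \<in> B. p u = i}. D i u \<subseteq> {j. j < k \<and> i \<in> c j} \<and> card (D i u) = w u)
      \<and> disjoint_family_on (D i) {u \<in> B. p u = i}"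
  proof (intro bchoice ballI)
    fix i assume "i \<in> B'"
    show "\<exists>D. (\<forall>u\<in>{u \<in> B. p u = i}. D u \<subseteq> {j. j < k \<and> i \<in> c j} \<and> card (D u) = w u)
      \<and> disjoint_family_on D {u \<in> B. p u = i}"
      by (rule ex_disjoint_subsets[of "{u \<in> B. p u = i}" "{j. j < k \<and> i \<in> c j}" w])
        (use \<open>finite B\<close> card le \<open>i \<in> B'\<close> in auto)
  qed
  then obtain D where D0: "\<forall>i\<in>B'. (\<forall>u\<in>{u \<in> B. p u = i}. D i u \<subseteq> {j. j < k \<and> i \<in> c j} \<and> card (D i u) = w u)
      \<and> disjoint_family_on (D i) {u \<in> B. p u = i}" ..
  then have D: "\<And>i u. i \<in> B' \<Longrightarrow> u \<in> B \<Longrightarrow> p u = i \<Longrightarrow> D i u \<subseteq> {j. j < k \<and> i \<in> c j} \<and> card (D i u) = w u"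
    and disj: "\<And>i. i \<in> B' \<Longrightarrow> disjoint_family_on (D i) {u \<in> B. p u = i}" by blast+
  define d where "d j = {u \<in> B. 0 < w u \<and> j \<in> D (p u) u}" for j
  have "card {j. j < k \<and> u \<in> d j} = w u" if u: "u \<in> B" for u
  proof (cases "w u = 0")
    case False
    then have "p u \<in> B'" using p u by blast
    from D[OF this u refl] have "{j. j < k \<and> u \<in> d j} = D (p u) u" using u False by (auto simp: d_def)
    then show ?thesis using D[OF \<open>p u \<in> B'\<close> u refl] by simp
  qed (simp add: d_def)
  moreover have "\<not> E u v" if j: "j < k" "u \<in> d j" "v \<in> d j" for j u v
  proof
    assume "E u v"
    have uv: "u \<in> B" "v \<in> B" "0 < w u" "0 < w v" "j \<in> D (p u) u" "j \<in> D (p v) v"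
      using j by (auto simp: d_def)
    then have *: "p u \<in> B'" "p v \<in> B'" using p by auto
    have "p u \<in> c j" "p v \<in> c j" using D[OF *(1) uv(1) refl] D[OF *(2) uv(2) refl] uv by auto
    then have "u \<noteq> v" "p u = p v" using E[OF uv(1-4) \<open>E u v\<close>] c j by blast+
    then show False using disj[OF *(1)] uv by (auto simp: disjoint_family_on_def)
  qed
  moreover have "d j \<subseteq> B" for j by (auto simp: d_def)
  ultimately show ?thesis
    unfolding multicolourable_def by (intro exI[of _ d]) simp
qed

section \<open>Base graphs and the linear conditions on a minimal counterexample\<close>

definition all_of :: "bool list \<Rightarrow> bool" where "all_of ps \<longleftrightarrow> list_all id ps"
definition any_of :: "bool list \<Rightarrow> bool" where "any_of ps \<longleftrightarrow> list_ex id ps"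

lemma all_of_iff: "all_of ps \<longleftrightarrow> (\<forall>p\<in>set ps. p)" by (simp add: all_of_def list_all_iff)
lemma any_of_iff: "any_of ps \<longleftrightarrow> (\<exists>p\<in>set ps. p)" by (simp add: any_of_def list_ex_iff)

text \<open>Conjunctions and disjunctions are kept as lists that the code simplifier does not unfold, so that it evaluates
  all members of a list even if some of them contain free variables.\<close>

declare [[code abort: all_of any_of]]

lemmas list_connective_simps =
  all_of_def any_of_def list.pred_inject list_ex_Nil_iff list_ex_Cons_iff id_apply HOL.simp_thms not_False_eq_True

text \<open>A base graph has the vertices \<open>0, \<dots>, n - 1\<close>; it is given by its adjacency lists and by a list of cliques, among
  which all maximal ones have to occur.\<close>

definition base_graph :: "nat list list \<Rightarrow> nat list list \<Rightarrow> bool" where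
  "base_graph nb cl \<longleftrightarrow>
     (\<forall>u\<in>set [0..<length nb]. distinct (u # nb ! u) \<and> (\<forall>v\<in>set (nb ! u). v < length nb \<and> u \<in> set (nb ! v))) \<and>
     (\<forall>K\<in>set cl. distinct K \<and> (\<forall>u\<in>set K. u < length nb \<and> (\<forall>v\<in>set K. u = v \<or> v \<in> set (nb ! u))))"

definition wsum :: "(nat \<Rightarrow> nat) \<Rightarrow> nat list \<Rightarrow> nat" where
  "wsum w xs = sum_list (map w xs)"

text \<open>For a blow-up with cliques of size \<open>w v\<close>, the first sum is the degree plus
  one of any vertex in the clique of \<open>v\<close>, and the second is the size of a clique
  containing it. If all maximal cliques occur in \<open>cl\<close>, this says that the maximum in
  the theorem is at most \<open>k\<close>, with the ceiling cleared.\<close>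

definition gamma_le :: "nat list list \<Rightarrow> nat list list \<Rightarrow> nat \<Rightarrow> (nat \<Rightarrow> nat) \<Rightarrow> bool" where
  "gamma_le nb cl k w \<longleftrightarrow>
     (\<forall>K\<in>set cl. \<forall>v\<in>set K. 0 < w v \<longrightarrow> wsum w (v # nb ! v) + wsum w K \<le> 2 * k)"

definition base_colourable :: "nat list list \<Rightarrow> nat \<Rightarrow> (nat \<Rightarrow> nat) \<Rightarrow> bool" where
  "base_colourable nb = multicolourable (\<lambda>u v. v \<in> set (nb ! u)) {..<length nb}"

definition gamma_colourable :: "nat list list \<Rightarrow> nat list list \<Rightarrow> (nat \<Rightarrow> nat) \<Rightarrow> bool" where
  "gamma_colourable nb cl w \<longleftrightarrow> (\<forall>k. gamma_le nb cl k w \<longrightarrow> base_colourable nb k w)"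

definition hits :: "nat list list \<Rightarrow> nat \<Rightarrow> nat" where
  "hits Ss v = length (filter (\<lambda>S. v \<in> set S) Ss)"

text \<open>Empty sets are excluded so that every move lowers the total weight, on which the
  induction runs.\<close>

definition stable_list :: "nat list list \<Rightarrow> nat list \<Rightarrow> bool" where
  "stable_list nb S \<longleftrightarrow> S \<noteq> [] \<and> (\<forall>u\<in>set S. u < length nb \<and> (\<forall>v\<in>set S. v \<notin> set (nb ! u)))"

definition valid_moves :: "nat list list \<Rightarrow> nat list list list \<Rightarrow> bool" where
  "valid_moves nb Ms \<longleftrightarrow> list_all (\<lambda>Ss. Ss \<noteq> [] \<and> list_all (stable_list nb) Ss) Ms"

text \<open>The entries of \<open>W\<close> may be variables; evaluation then yields an explicit
  linear term.\<close>

definition msum :: "int list \<Rightarrow> nat list \<Rightarrow> int" where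
  "msum W xs = foldr (+) (map ((!) W) xs) 0"

text \<open>\<open>W\<close>, \<open>D\<close> and \<open>Q\<close> list the weights of the vertices, of their closed neighbourhoods and of the cliques.  Removing
  the stable sets \<open>Ss\<close> fails to lower the bound only if one of these disjuncts holds; pairs \<open>(v, i)\<close> that lose at
  least \<open>2 * length Ss\<close> cannot fail.\<close>

definition blocked :: "nat list list \<Rightarrow> nat list list \<Rightarrow> int list \<Rightarrow> int list \<Rightarrow> int list \<Rightarrow> int \<Rightarrow> nat list list \<Rightarrow> bool" where
  "blocked nb cl D Q W k Ss \<longleftrightarrow> any_of (
     (k < int (length Ss)) # map (\<lambda>v. W ! v < int (hits Ss v)) (remdups (concat Ss)) @
     concat (map (\<lambda>i.
       map (\<lambda>v. all_of [int (hits Ss v) < W ! v,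
           2 * k < D ! v + Q ! i + int (2 * length Ss - (wsum (hits Ss) (v # nb ! v) + wsum (hits Ss) (cl ! i)))])
         (filter (\<lambda>v. wsum (hits Ss) (v # nb ! v) + wsum (hits Ss) (cl ! i) < 2 * length Ss) (cl ! i)))
       [0..<length cl]))"

text \<open>The properties of a minimal counterexample with respect to the lists of stable sets in \<open>Ms\<close>.\<close>

definition stuck :: "nat list list \<Rightarrow> nat list list \<Rightarrow> int list \<Rightarrow> int list \<Rightarrow> int list \<Rightarrow> int \<Rightarrow> nat list list list \<Rightarrow> bool" where
  "stuck nb cl D Q W k Ms \<longleftrightarrow> all_of (
     map (\<lambda>v. D ! v = msum W (v # nb ! v)) [0..<length nb] @
     map (\<lambda>i. Q ! i = msum W (cl ! i)) [0..<length cl] @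
     map (\<lambda>v. all_of [0 \<le> W ! v, any_of [W ! v \<le> 0, k < D ! v]]) [0..<length nb] @
     concat (map (\<lambda>i. map (\<lambda>v. any_of [W ! v \<le> 0, D ! v + Q ! i \<le> 2 * k]) (cl ! i)) [0..<length cl]) @
     map (blocked nb cl D Q W k) Ms)"

lemma wsum_mono: "(\<And>v. w v \<le> w' v) \<Longrightarrow> wsum w xs \<le> wsum w' xs"
  by (induction xs) (auto simp: wsum_def intro: add_mono)

lemma wsum_diff:
  assumes "\<And>v. x v \<le> w v"
  shows "wsum (\<lambda>v. w v - x v) xs + wsum x xs = wsum w xs"
proof (induction xs)
  case (Cons a xs)
  then show ?case using assms[of a] by (simp add: wsum_def)
qed (simp add: wsum_def)

lemma wsum_eq_sum: "distinct xs \<Longrightarrow> wsum w xs = sum w (set xs)"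
  by (simp add: wsum_def sum_list_distinct_conv_sum_set)

lemma gamma_le_mono:
  assumes "gamma_le nb cl k w" and le: "\<And>v. w' v \<le> w v"
  shows "gamma_le nb cl k w'"
  unfolding gamma_le_def
proof (intro ballI impI)
  fix K v assume "K \<in> set cl" "v \<in> set K" "0 < w' v"
  then have "wsum w (v # nb ! v) + wsum w K \<le> 2 * k"
    using assms(1) le[of v] unfolding gamma_le_def by (simp add: less_le_trans)
  then show "wsum w' (v # nb ! v) + wsum w' K \<le> 2 * k"
    using wsum_mono[of w' w "v # nb ! v", OF le] wsum_mono[of w' w K, OF le] by linarith
qed

lemma base_colourable_Suc:
  assumes "base_colourable nb k (\<lambda>v. w v - of_bool (v \<in> set S))" "stable_list nb S" "\<And>v. v \<in> set S \<Longrightarrow> 0 < w v"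
  shows "base_colourable nb (Suc k) w"
  using assms unfolding base_colourable_def by (intro multicolourable_Suc) (auto simp: stable_list_def)

text \<open>Each stable set in \<open>Ss\<close> receives a new colour of its own.\<close>

lemma base_colourable_move:
  assumes "list_all (stable_list nb) Ss" "\<And>v. hits Ss v \<le> w v" "base_colourable nb k (\<lambda>v. w v - hits Ss v)"
  shows "base_colourable nb (k + length Ss) w"
  using assms
proof (induction Ss arbitrary: w)
  case (Cons S Ss)
  have h: "hits (S # Ss) v = of_bool (v \<in> set S) + hits Ss v" for v by (simp add: hits_def)
  have le: "of_bool (v \<in> set S) + hits Ss v \<le> w v" for v using Cons.prems(2)[of v] h by simp
  have "base_colourable nb (k + length Ss) (\<lambda>v. w v - of_bool (v \<in> set S))"
  proof (rule Cons.IH)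
    show "hits Ss v \<le> w v - of_bool (v \<in> set S)" for v using le[of v] by simp
  qed (use Cons.prems h in simp_all)
  moreover have "0 < w v" if "v \<in> set S" for v using le[of v] that by simp
  ultimately have "base_colourable nb (Suc (k + length Ss)) w"
    using Cons.prems(1) by (intro base_colourable_Suc) auto
  then show ?case by simp
qed (simp add: hits_def)

lemma msum_eq:
  "(\<And>v. v \<in> set xs \<Longrightarrow> v < n) \<Longrightarrow> msum (map (\<lambda>v. int (w v)) [0..<n]) xs = int (wsum w xs)"
  by (induction xs) (auto simp: msum_def wsum_def)

lemma base_graphD:
  assumes "base_graph nb cl"
  shows "u < length nb \<Longrightarrow> distinct (u # nb ! u)"
    and "u < length nb \<Longrightarrow> v \<in> set (nb ! u) \<Longrightarrow> v < length nb"
    and "u < length nb \<Longrightarrow> v \<in> set (nb ! u) \<Longrightarrow> u \<in> set (nb ! v)"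
    and "K \<in> set cl \<Longrightarrow> distinct K"
    and "K \<in> set cl \<Longrightarrow> v \<in> set K \<Longrightarrow> v < length nb"
    and "K \<in> set cl \<Longrightarrow> u \<in> set K \<Longrightarrow> v \<in> set K \<Longrightarrow> u = v \<or> v \<in> set (nb ! u)"
  using assms unfolding base_graph_def set_upt Ball_def atLeastLessThan_iff by blast+

lemma in_concat_map_filter:
  "i \<in> set xs \<Longrightarrow> v \<in> set (g i) \<Longrightarrow> P i v \<Longrightarrow> f i v \<in> set (concat (map (\<lambda>i. map (f i) (filter (P i) (g i))) xs))"
  by auto

text \<open>Negating the disjuncts gives what a successful move needs: enough colours, enough weight
  at each vertex used, and slack at each pair of a vertex and a clique that loses less than
  \<open>2 * length Ss\<close>.\<close>

lemma not_blockedD: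
  assumes "\<not> blocked nb cl D Q W k Ss"
  shows "int (length Ss) \<le> k"
    and "v \<in> set (concat Ss) \<Longrightarrow> int (hits Ss v) \<le> W ! v"
    and "i < length cl \<Longrightarrow> v \<in> set (cl ! i) \<Longrightarrow>
      wsum (hits Ss) (v # nb ! v) + wsum (hits Ss) (cl ! i) < 2 * length Ss \<Longrightarrow> int (hits Ss v) < W ! v \<Longrightarrow>
      D ! v + Q ! i + int (2 * length Ss - (wsum (hits Ss) (v # nb ! v) + wsum (hits Ss) (cl ! i))) \<le> 2 * k"
proof -
  show "int (length Ss) \<le> k"
    using assms unfolding blocked_def any_of_def by simp
  show "int (hits Ss v) \<le> W ! v" if "v \<in> set (concat Ss)"
  proof (rule ccontr)
    assume lt: "\<not> ?thesis"
    have "(W ! v < int (hits Ss v)) \<in> set (map (\<lambda>v. W ! v < int (hits Ss v)) (remdups (concat Ss)))"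
      unfolding set_map set_remdups using that by (rule imageI)
    then have "blocked nb cl D Q W k Ss"
      unfolding blocked_def any_of_iff set_append list.set
      by (intro bexI[where x = "W ! v < int (hits Ss v)"] insertI2 UnI1) (use lt in linarith)
    then show False using assms by blast
  qed
  show "D ! v + Q ! i + int (2 * length Ss - (wsum (hits Ss) (v # nb ! v) + wsum (hits Ss) (cl ! i))) \<le> 2 * k"
    if "i < length cl" "v \<in> set (cl ! i)" "wsum (hits Ss) (v # nb ! v) + wsum (hits Ss) (cl ! i) < 2 * length Ss"
      "int (hits Ss v) < W ! v"
  proof (rule ccontr)
    let ?c = "\<lambda>i v. all_of [int (hits Ss v) < W ! v,
           2 * k < D ! v + Q ! i + int (2 * length Ss - (wsum (hits Ss) (v # nb ! v) + wsum (hits Ss) (cl ! i)))]"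
    assume "\<not> ?thesis"
    then have "?c i v" using that(4) by (simp add: all_of_def)
    moreover have "?c i v \<in> set (concat (map (\<lambda>i. map (?c i)
         (filter (\<lambda>v. wsum (hits Ss) (v # nb ! v) + wsum (hits Ss) (cl ! i) < 2 * length Ss) (cl ! i)))
       [0..<length cl]))"
      by (rule in_concat_map_filter[where f = ?c and g = "(!) cl"]) (use that in simp_all)
    ultimately have "blocked nb cl D Q W k Ss"
      unfolding blocked_def any_of_iff set_append list.set
      by (intro bexI[where x = "?c i v"] insertI2 UnI2)
    then show False using assms by blast
  qed
qed

lemma stuckI:
  assumes "\<And>v. v < length nb \<Longrightarrow> D ! v = msum W (v # nb ! v)"
    and "\<And>i. i < length cl \<Longrightarrow> Q ! i = msum W (cl ! i)"
    and "\<And>v. v < length nb \<Longrightarrow> 0 \<le> W ! v \<and> (W ! v \<le> 0 \<or> k < D ! v)"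
    and "\<And>i v. i < length cl \<Longrightarrow> v \<in> set (cl ! i) \<Longrightarrow> W ! v \<le> 0 \<or> D ! v + Q ! i \<le> 2 * k"
    and "\<And>Ss. Ss \<in> set Ms \<Longrightarrow> blocked nb cl D Q W k Ss"
  shows "stuck nb cl D Q W k Ms"
proof -
  have two: "any_of [a, b] \<longleftrightarrow> a \<or> b" "all_of [a, b] \<longleftrightarrow> a \<and> b" for a b
    by (auto simp: all_of_iff any_of_iff)
  show ?thesis
    unfolding stuck_def all_of_iff set_append ball_Un set_map set_concat ball_UN ball_simps
    unfolding two
    using assms by auto
qed

text \<open>If \<open>w\<close> failed for some \<open>k\<close> while all smaller total weights
  succeed, then \<open>w\<close> would be \<open>stuck\<close>. The hypothesis \<open>num\<close>
  refutes this for arbitrary \<open>d\<close>, \<open>q\<close> and \<open>k\<close>: since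
  \<open>stuck\<close> itself ties the sums to the weights by equations, the refutation is a problem
  of linear integer arithmetic.\<close>

lemma gamma_colourable_step:
  assumes bg: "base_graph nb cl"
    and IH: "\<And>w'. sum w' {..<length nb} < sum w {..<length nb} \<Longrightarrow> gamma_colourable nb cl w'"
    and Ms: "valid_moves nb Ms"
    and num: "\<And>d q k. 0 < sum w {..<length nb} \<Longrightarrow>
      \<not> stuck nb cl (map d [0..<length nb]) (map q [0..<length cl]) (map (\<lambda>v. int (w v)) [0..<length nb]) k Ms"
  shows "gamma_colourable nb cl w"
  unfolding gamma_colourable_def
proof (intro allI impI)
  fix k assume gamma_le: "gamma_le nb cl k w"
  let ?n = "length nb"
  let ?d = "\<lambda>v. wsum w (v # nb ! v)" and ?q = "\<lambda>i. wsum w (cl ! i)"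
  note bg = base_graphD[OF bg]
  note nb_dist = bg(1) and nb_lt = bg(2) and nb_sym = bg(3)
  have cl: "v < ?n" if "i < length cl" "v \<in> set (cl ! i)" for i v
    using bg(5)[OF nth_mem[OF that(1)] that(2)] .
  show "base_colourable nb k w"
  proof (rule ccontr)
    assume not: "\<not> base_colourable nb k w"
    have "0 < sum w {..<?n}"
    proof (rule ccontr)
      assume "\<not> 0 < sum w {..<?n}"
      then have "base_colourable nb k w" unfolding base_colourable_def by (intro multicolourable_zero) simp
      then show False using not by blast
    qed
    \<comment> \<open>Otherwise one unit of \<open>v\<close> could be set aside, the rest coloured
      by \<open>IH\<close>, and the unit restored by \<open>multicolourable_greedy\<close>.\<close>
    have deg: "k < ?d v" if v: "v < ?n" "0 < w v" for v
    proof (rule ccontr)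
      assume "\<not> k < ?d v"
      have eq: "{u \<in> {..<?n}. u = v \<or> u \<in> set (nb ! v)} = set (v # nb ! v)"
        using nb_lt[OF v(1)] v(1) by auto
      have "sum (w(v := w v - 1)) {..<?n} < sum w {..<?n}"
        by (rule sum_strict_mono_ex1) (use v in auto)
      then have col: "base_colourable nb k (w(v := w v - 1))"
        using IH[of "w(v := w v - 1)"] gamma_le_mono[OF gamma_le, of "w(v := w v - 1)"] by (simp add: gamma_colourable_def)
      have "multicolourable (\<lambda>u v. v \<in> set (nb ! u)) {..<?n} k w"
      proof (rule multicolourable_greedy[where v = v])
        show "sum w {u \<in> {..<?n}. u = v \<or> u \<in> set (nb ! v)} \<le> k"
          unfolding eq using \<open>\<not> k < ?d v\<close> wsum_eq_sum[OF nb_dist[OF v(1)], of w] by linarith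
        show "u \<in> set (nb ! v)" if "u \<in> {..<?n}" "v \<in> set (nb ! u)" for u using nb_sym that by simp
        show "v \<notin> set (nb ! v)" using nb_dist[OF v(1)] by simp
      qed (use v col in \<open>simp_all add: base_colourable_def\<close>)
      then show False using not by (simp add: base_colourable_def)
    qed
    have blocked: "blocked nb cl (map (\<lambda>v. int (?d v)) [0..<?n]) (map (\<lambda>i. int (?q i)) [0..<length cl])
        (map (\<lambda>v. int (w v)) [0..<?n]) (int k) Ss" (is ?blocked) if "Ss \<in> set Ms" for Ss
    proof (rule ccontr)
      assume nbl: "\<not> ?blocked"
      have Ss: "Ss \<noteq> []" "list_all (stable_list nb) Ss" using Ms that by (auto simp: valid_moves_def list_all_iff)
      have lt: "v < ?n" if v: "v \<in> set (concat Ss)" for v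
      proof -
        obtain S where "S \<in> set Ss" "v \<in> set S" using v by auto
        then show ?thesis using Ss(2) unfolding list_all_iff stable_list_def by blast
      qed
      have k: "length Ss \<le> k" using not_blockedD(1)[OF nbl] by simp
      have h: "hits Ss v \<le> w v" for v
      proof (cases "v \<in> set (concat Ss)")
        case True
        then show ?thesis using not_blockedD(2)[OF nbl True] lt[OF True] by simp
      next
        case False
        then have "hits Ss v = 0" by (auto simp: hits_def filter_empty_conv)
        then show ?thesis by simp
      qed
      let ?w = "\<lambda>v. w v - hits Ss v"
      have "gamma_le nb cl (k - length Ss) ?w"
        unfolding gamma_le_def
      proof (intro ballI impI)
        fix K v assume K: "K \<in> set cl" "v \<in> set K" and v: "0 < ?w v"
        then obtain i where i: "i < length cl" "K = cl ! i" by (metis in_set_conv_nth)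
        have vn: "v < ?n" using cl i K by blast
        have le: "?d v + wsum w K \<le> 2 * k" using gamma_le K v by (auto simp: gamma_le_def)
        \<comment> \<open>With \<open>length Ss\<close> fewer colours the bound must fall by
          \<open>2 * length Ss\<close>. Either the move removes that much, or the third part of
          \<open>not_blockedD\<close> supplies the difference as slack.\<close>
        have "?d v + wsum w K + 2 * length Ss \<le> 2 * k + (wsum (hits Ss) (v # nb ! v) + wsum (hits Ss) K)"
        proof (cases "wsum (hits Ss) (v # nb ! v) + wsum (hits Ss) K < 2 * length Ss")
          case True
          from not_blockedD(3)[OF nbl i(1) K(2)[unfolded i(2)] this[unfolded i(2)]] show ?thesis
            using True v i vn by (simp add: of_nat_diff)
        qed (use le in linarith)
        then show "wsum ?w (v # nb ! v) + wsum ?w K \<le> 2 * (k - length Ss)"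
          using wsum_diff[of "hits Ss" w "v # nb ! v", OF h] wsum_diff[of "hits Ss" w K, OF h] k by linarith
      qed
      moreover have "sum ?w {..<?n} < sum w {..<?n}"
      proof -
        obtain S Ss' where S: "Ss = S # Ss'" using Ss(1) by (cases Ss) auto
        then obtain v where v: "v \<in> set S" using Ss(2) by (cases S) (auto simp: stable_list_def)
        then have "v < ?n" "0 < hits Ss v" using lt[of v] S by (auto simp: hits_def)
        then show ?thesis using h[of v] by (intro sum_strict_mono_ex1) (auto intro!: bexI[of _ v])
      qed
      ultimately have "base_colourable nb (k - length Ss) ?w" using IH by (auto simp: gamma_colourable_def)
      then have "base_colourable nb (k - length Ss + length Ss) w" using Ss(2) h by (intro base_colourable_move)
      then show False using not k by simp
    qed
    have "stuck nb cl (map (\<lambda>v. int (?d v)) [0..<?n]) (map (\<lambda>i. int (?q i)) [0..<length cl])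
        (map (\<lambda>v. int (w v)) [0..<?n]) (int k) Ms"
    proof (rule stuckI)
      fix v assume v: "v < ?n"
      have "msum (map (\<lambda>v. int (w v)) [0..<?n]) (v # nb ! v) = int (?d v)"
        by (rule msum_eq) (use nb_lt[OF v] v in auto)
      then show "map (\<lambda>v. int (?d v)) [0..<?n] ! v = msum (map (\<lambda>v. int (w v)) [0..<?n]) (v # nb ! v)"
        using v by simp
      show "0 \<le> map (\<lambda>v. int (w v)) [0..<?n] ! v \<and>
          (map (\<lambda>v. int (w v)) [0..<?n] ! v \<le> 0 \<or> int k < map (\<lambda>v. int (?d v)) [0..<?n] ! v)"
        using v deg[OF v] by (cases "w v = 0") simp_all
    next
      fix i assume i: "i < length cl"
      have "msum (map (\<lambda>v. int (w v)) [0..<?n]) (cl ! i) = int (?q i)"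
        by (rule msum_eq) (rule cl[OF i])
      then show "map (\<lambda>i. int (?q i)) [0..<length cl] ! i = msum (map (\<lambda>v. int (w v)) [0..<?n]) (cl ! i)"
        using i by simp
    next
      fix i v assume i: "i < length cl" "v \<in> set (cl ! i)"
      have "?d v + ?q i \<le> 2 * k" if "0 < w v"
        using gamma_le nth_mem[OF i(1)] i(2) that unfolding gamma_le_def by blast
      then show "map (\<lambda>v. int (w v)) [0..<?n] ! v \<le> 0 \<or>
          map (\<lambda>v. int (?d v)) [0..<?n] ! v + map (\<lambda>i. int (?q i)) [0..<length cl] ! i \<le> 2 * int k"
        using i(1) cl[OF i] by (cases "w v = 0") simp_all
    qed (rule blocked)
    then show False using num[OF \<open>0 < sum w {..<?n}\<close>] by blast
  qed
qed

lemma gamma_colourable_transfer: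
  assumes "\<And>k. gamma_le nb cl k w \<Longrightarrow> gamma_le nb' cl' k w'" "gamma_colourable nb' cl' w'"
    and "\<And>u. u < length nb \<Longrightarrow> 0 < w u \<Longrightarrow> p u < length nb'"
    and "\<And>i. i < length nb' \<Longrightarrow> sum w {u. u < length nb \<and> p u = i} \<le> w' i"
    and "\<And>u v. u < length nb \<Longrightarrow> v < length nb \<Longrightarrow> 0 < w u \<Longrightarrow> 0 < w v \<Longrightarrow> v \<in> set (nb ! u) \<Longrightarrow>
      u \<noteq> v \<and> (p u = p v \<or> p v \<in> set (nb' ! p u))"
  shows "gamma_colourable nb cl w"
  unfolding gamma_colourable_def base_colourable_def
proof (intro allI impI)
  fix k assume "gamma_le nb cl k w"
  then have "multicolourable (\<lambda>u v. v \<in> set (nb' ! u)) {..<length nb'} k w'"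
    using assms(1,2) by (simp add: gamma_colourable_def base_colourable_def)
  then show "multicolourable (\<lambda>u v. v \<in> set (nb ! u)) {..<length nb} k w"
    by (rule multicolourable_transfer[where p = p, rotated]) (use assms(3-) in auto)
qed

section \<open>Symmetries and merging of base vertices\<close>

text \<open>Permutations are lists, with \<open>Q\<close> inverse to \<open>P\<close>. Comparing
  sorted images with the stored lists presupposes that neighbours and cliques are listed in
  increasing order.\<close>

definition automorphism :: "nat list list \<Rightarrow> nat list list \<Rightarrow> nat list \<Rightarrow> nat list \<Rightarrow> bool" where
  "automorphism nb cl P Q \<longleftrightarrow>
     (\<forall>v\<in>set [0..<length nb]. P ! v < length nb \<and> Q ! v < length nb \<and> Q ! (P ! v) = v \<and> P ! (Q ! v) = v \<and>
        sort (map ((!) P) (nb ! v)) = nb ! (P ! v)) \<and>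
     (\<forall>K\<in>set cl. sort (map ((!) P) K) \<in> set cl)"

lemma automorphismD:
  assumes "automorphism nb cl P Q" "v < length nb"
  shows "P ! v < length nb" "Q ! v < length nb" "Q ! (P ! v) = v" "P ! (Q ! v) = v"
    "nb ! (P ! v) = sort (map ((!) P) (nb ! v))"
  using assms unfolding automorphism_def set_upt Ball_def atLeastLessThan_iff by (metis le0)+

lemma sum_automorphism:
  assumes "automorphism nb cl P Q"
  shows "sum (\<lambda>v. w (P ! v)) {..<length nb} = sum w {..<length nb}"
  by (rule sum.reindex_bij_witness[where i = "(!) Q" and j = "(!) P"]) (use automorphismD[OF assms] in auto)

lemma wsum_sort_map: "wsum w (sort (map f xs)) = wsum (\<lambda>v. w (f v)) xs"
proof -
  have "mset (map w (sort (map f xs))) = mset (map (\<lambda>v. w (f v)) xs)" by (simp add: multiset.map_comp comp_def)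
  then show ?thesis unfolding wsum_def by (metis sum_mset_sum_list)
qed

text \<open>A colouring for the weights \<open>w (P ! v)\<close> is pulled back along the inverse
  \<open>Q\<close>. The bound transfers because \<open>P\<close> maps neighbourhoods to
  neighbourhoods and listed cliques to listed cliques.\<close>

lemma gamma_colourable_automorphism:
  assumes bg: "base_graph nb cl" and aut: "automorphism nb cl P Q" and gamma_colourable: "gamma_colourable nb cl (\<lambda>v. w (P ! v))"
  shows "gamma_colourable nb cl w"
proof (rule gamma_colourable_transfer[OF _ gamma_colourable, where p = "(!) Q"])
  note P = automorphismD[OF aut]
  show "gamma_le nb cl k (\<lambda>v. w (P ! v))" if "gamma_le nb cl k w" for k
    unfolding gamma_le_def
  proof (intro ballI impI)
    fix K v assume K: "K \<in> set cl" "v \<in> set K" and v: "0 < w (P ! v)"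
    have "sort (map ((!) P) K) \<in> set cl" using aut K(1) unfolding automorphism_def by blast
    moreover have "P ! v \<in> set (sort (map ((!) P) K))" using K(2) by simp
    ultimately have "wsum w (P ! v # nb ! (P ! v)) + wsum w (sort (map ((!) P) K)) \<le> 2 * k"
      using that v unfolding gamma_le_def by blast
    moreover have "wsum w (P ! v # nb ! (P ! v)) = wsum (\<lambda>v. w (P ! v)) (v # nb ! v)"
      using P(5)[OF base_graphD(5)[OF bg K]] wsum_sort_map[of w "(!) P" "nb ! v"] by (simp add: wsum_def)
    ultimately show "wsum (\<lambda>v. w (P ! v)) (v # nb ! v) + wsum (\<lambda>v. w (P ! v)) K \<le> 2 * k"
      by (simp add: wsum_sort_map)
  qed
  show "sum w {u. u < length nb \<and> Q ! u = i} \<le> w (P ! i)" for i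
  proof -
    have "u = P ! i" if "u < length nb" "Q ! u = i" for u using P(4)[OF that(1)] that(2) by simp
    then have "{u. u < length nb \<and> Q ! u = i} \<subseteq> {P ! i}" by blast
    then have "sum w {u. u < length nb \<and> Q ! u = i} \<le> sum w {P ! i}" by (intro sum_mono2) auto
    then show ?thesis by simp
  qed
  show "u \<noteq> v \<and> (Q ! u = Q ! v \<or> Q ! v \<in> set (nb ! (Q ! u)))"
    if "u < length nb" "v < length nb" "v \<in> set (nb ! u)" for u v
  proof -
    have "v \<in> set (sort (map ((!) P) (nb ! (Q ! u))))"
      using P(5)[OF P(2)[OF that(1)]] P(4)[OF that(1)] that(3) by simp
    then obtain x where x: "x \<in> set (nb ! (Q ! u))" "v = P ! x" by auto
    then have "Q ! v = x" using P(3)[OF base_graphD(2)[OF bg P(2)[OF that(1)] x(1)]] by simp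
    moreover have "u \<noteq> v" using base_graphD(1)[OF bg that(1)] that(3) by auto
    ultimately show ?thesis using x by blast
  qed
qed (use automorphismD(2)[OF aut] in simp)

text \<open>Merging vertices by \<open>p\<close> preserves the bound and the colourability, provided that no edge listed in \<open>X\<close> joins
  two vertices of positive weight.\<close>

definition pushes :: "nat list list \<Rightarrow> nat list list \<Rightarrow> nat list list \<Rightarrow> nat list list \<Rightarrow> nat list \<Rightarrow> (nat \<times> nat) list \<Rightarrow> bool" where
  "pushes nb cl nb' cl' p X \<longleftrightarrow> (\<forall>u\<in>set [0..<length nb].
     p ! u < length nb' \<and>
     (\<forall>x\<in>set [0..<length nb]. p ! x \<in> set (p ! u # nb' ! (p ! u)) \<longrightarrow> x \<in> set (u # nb ! u)) \<and>
     (\<forall>K'\<in>set cl'. p ! u \<in> set K' \<longrightarrow> (\<exists>K\<in>set cl. u \<in> set K \<and> (\<forall>x\<in>set [0..<length nb]. p ! x \<in> set K' \<longrightarrow> x \<in> set K))) \<and>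
     (\<forall>v\<in>set (nb ! u). (u, v) \<in> set X \<or> p ! u = p ! v \<or> p ! v \<in> set (nb' ! (p ! u))))"

definition push :: "nat list list \<Rightarrow> nat list \<Rightarrow> (nat \<Rightarrow> nat) \<Rightarrow> nat \<Rightarrow> nat" where
  "push nb p w i = sum w {u \<in> {..<length nb}. p ! u = i}"

lemma wsum_push:
  assumes "distinct xs"
  shows "wsum (push nb p w) xs = sum w {u \<in> {..<length nb}. p ! u \<in> set xs}"
proof -
  let ?A = "{u \<in> {..<length nb}. p ! u \<in> set xs}"
  have "sum w ?A = (\<Sum>i\<in>set xs. sum w {u \<in> ?A. p ! u = i})"
    by (rule sum.group[symmetric]) auto
  also have "\<dots> = (\<Sum>i\<in>set xs. push nb p w i)"
    unfolding push_def by (intro sum.cong arg_cong[of _ _ "sum w"]) auto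
  finally show ?thesis using assms by (simp add: wsum_eq_sum)
qed

lemma sum_push:
  assumes "pushes nb cl nb' cl' p X"
  shows "sum (push nb p w) {..<length nb'} = sum w {..<length nb}"
  unfolding push_def by (rule sum.group) (use assms in \<open>auto simp: pushes_def\<close>)

text \<open>The preimage of a closed neighbourhood or a clique around \<open>i\<close> lies in a
  closed neighbourhood or a clique around any vertex \<open>u\<close> of the fibre, so the bound
  cannot grow. Colours are pulled back along \<open>p\<close>; only edges in \<open>X\<close> can
  get lost, and these have an end of weight 0.\<close>

lemma gamma_colourable_push:
  assumes bg: "base_graph nb cl" "base_graph nb' cl'" and p: "pushes nb cl nb' cl' p X"
    and X: "\<forall>(u, v)\<in>set X. w u = 0 \<or> w v = 0" and gamma_colourable: "gamma_colourable nb' cl' (push nb p w)"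
  shows "gamma_colourable nb cl w"
proof (rule gamma_colourable_transfer[OF _ gamma_colourable, where p = "(!) p"])
  have u_mem: "u \<in> set [0..<length nb]" if "u < length nb" for u using that by simp
  note p_at = bspec[OF p[unfolded pushes_def] u_mem]
  note p_lt = p_at[THEN conjunct1]
    and p_nb = p_at[THEN conjunct2, THEN conjunct1, THEN bspec, OF _ u_mem, rule_format]
    and p_cl = p_at[THEN conjunct2, THEN conjunct2, THEN conjunct1, THEN bspec, rule_format]
    and p_edge = p_at[THEN conjunct2, THEN conjunct2, THEN conjunct2, THEN bspec]
  show "gamma_le nb' cl' k (push nb p w)" if gamma_le: "gamma_le nb cl k w" for k
    unfolding gamma_le_def
  proof (intro ballI impI)
    fix K' i assume K': "K' \<in> set cl'" "i \<in> set K'" and pos: "0 < push nb p w i"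
    \<comment> \<open>\<open>gamma_le\<close> constrains only vertices of positive weight, so the
      representative of the fibre has to be one of these.\<close>
    have "\<exists>u\<in>{u \<in> {..<length nb}. p ! u = i}. w u \<noteq> 0"
    proof (rule ccontr)
      assume "\<not> ?thesis"
      then have "push nb p w i = 0" unfolding push_def by (intro sum.neutral) blast
      then show False using pos by simp
    qed
    then obtain u where u: "u < length nb" "p ! u = i" "0 < w u" by auto
    obtain K where K: "K \<in> set cl" "u \<in> set K" "\<forall>x<length nb. p ! x \<in> set K' \<longrightarrow> x \<in> set K"
      using p_cl[OF u(1) K'(1)] K'(2) u(2) u_mem by blast
    have i: "i < length nb'" using base_graphD(5)[OF bg(2) K'] .
    have "wsum (push nb p w) (i # nb' ! i) = sum w {x \<in> {..<length nb}. p ! x \<in> set (i # nb' ! i)}"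
      by (rule wsum_push[OF base_graphD(1)[OF bg(2) i]])
    also have "\<dots> \<le> sum w (set (u # nb ! u))"
    proof (rule sum_mono2)
      show "{x \<in> {..<length nb}. p ! x \<in> set (i # nb' ! i)} \<subseteq> set (u # nb ! u)"
        using p_nb[OF u(1), unfolded u(2)] by blast
    qed simp_all
    also have "\<dots> = wsum w (u # nb ! u)" by (rule wsum_eq_sum[OF base_graphD(1)[OF bg(1) u(1)], symmetric])
    finally have 1: "wsum (push nb p w) (i # nb' ! i) \<le> wsum w (u # nb ! u)" .
    have "wsum (push nb p w) K' = sum w {x \<in> {..<length nb}. p ! x \<in> set K'}"
      by (rule wsum_push[OF base_graphD(4)[OF bg(2) K'(1)]])
    also have "\<dots> \<le> sum w (set K)" by (rule sum_mono2) (use K(3) in auto)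
    also have "\<dots> = wsum w K" by (rule wsum_eq_sum[OF base_graphD(4)[OF bg(1) K(1)], symmetric])
    finally have 2: "wsum (push nb p w) K' \<le> wsum w K" .
    have "wsum w (u # nb ! u) + wsum w K \<le> 2 * k" using gamma_le K(1,2) u(3) unfolding gamma_le_def by blast
    then show "wsum (push nb p w) (i # nb' ! i) + wsum (push nb p w) K' \<le> 2 * k" using 1 2 by linarith
  qed
  show "p ! u < length nb'" if "u < length nb" for u by (rule p_lt[OF that])
  show "sum w {u. u < length nb \<and> p ! u = i} \<le> push nb p w i" for i
    unfolding push_def by (rule eq_refl, rule arg_cong[of _ _ "sum w"]) auto
  show "u \<noteq> v \<and> (p ! u = p ! v \<or> p ! v \<in> set (nb' ! (p ! u)))"
    if u: "u < length nb" and v: "v \<in> set (nb ! u)" and pos: "0 < w u" "0 < w v" for u v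
  proof -
    have "(u, v) \<notin> set X" using X pos by auto
    moreover have "u \<noteq> v" using base_graphD(1)[OF bg(1) u] v by auto
    ultimately show ?thesis using p_edge[OF u v] by blast
  qed
qed

lemma push_eq: "push nb p w i = sum_list (map w (filter (\<lambda>u. p ! u = i) [0..<length nb]))"
proof -
  have "{u \<in> {..<length nb}. p ! u = i} = set (filter (\<lambda>u. p ! u = i) [0..<length nb])" by auto
  then show ?thesis unfolding push_def by (simp add: sum_list_distinct_conv_sum_set)
qed

section \<open>The icosahedron\<close>

text \<open>Vertex \<open>i\<close> is the one called v_i; \<open>G0_edge_iff\<close> confirms the
  table.\<close>

definition ico_nbs :: "nat list list" where
  "ico_nbs =
    [[1, 3, 5, 7, 9], [0, 2, 3, 9, 10], [1, 3, 4, 10, 11], [0, 1, 2, 4, 5],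
     [2, 3, 5, 6, 11], [0, 3, 4, 6, 7], [4, 5, 7, 8, 11], [0, 5, 6, 8, 9],
     [6, 7, 9, 10, 11], [0, 1, 7, 8, 10], [1, 2, 8, 9, 11], [2, 4, 6, 8, 10]]"

definition ico_cliques :: "nat list list" where
  "ico_cliques =
    [[0, 1, 3], [0, 1, 9], [0, 3, 5], [0, 5, 7], [0, 7, 9], [1, 2, 3],
     [1, 2, 10], [1, 9, 10], [2, 3, 4], [2, 4, 11], [2, 10, 11], [3, 4, 5],
     [4, 5, 6], [4, 6, 11], [5, 6, 7], [6, 7, 8], [6, 8, 11], [7, 8, 9],
     [8, 9, 10], [8, 10, 11]]"

text \<open>The graph \<open>G\<^sub>2\<close> with the vertices 1, 4, 6, 9 split: 10, 11, 12, 13 are the twins of 1, 4, 6, 9 that are not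
  adjacent to the other vertex of the matched pair, whereas 1 and 4 as well as 6 and 9 are adjacent.\<close>

definition fuzzy_nbs :: "nat list list" where
  "fuzzy_nbs =
    [[1, 3, 5, 7, 9, 10, 13], [0, 2, 3, 4, 9, 10, 13], [1, 3, 4, 10, 11], [0, 1, 2, 4, 5, 10, 11],
     [1, 2, 3, 5, 6, 11, 12], [0, 3, 4, 6, 7, 11, 12], [4, 5, 7, 8, 9, 11, 12], [0, 5, 6, 8, 9, 12, 13],
     [6, 7, 9, 12, 13], [0, 1, 6, 7, 8, 10, 13], [0, 1, 2, 3, 9, 13], [2, 3, 4, 5, 6, 12],
     [4, 5, 6, 7, 8, 11], [0, 1, 7, 8, 9, 10]]"

definition fuzzy_cliques :: "nat list list" where
  "fuzzy_cliques =
    [[0, 1, 3, 10], [0, 1, 9, 10, 13], [0, 3, 5], [0, 5, 7], [0, 7, 9, 13], [1, 2, 3, 4],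
     [1, 2, 3, 10], [2, 3, 4, 11], [3, 4, 5, 11], [4, 5, 6, 11, 12], [5, 6, 7, 12], [6, 7, 8, 9],
     [6, 7, 8, 12], [7, 8, 9, 13]]"

lemma length_simps:
  "length ico_nbs = 12" "length ico_cliques = 20" "length fuzzy_nbs = 14" "length fuzzy_cliques = 14"
  by code_simp+

lemma upt_simps:
  "[0..<12] = [0, 1, 2, 3, 4, 5, 6, 7, 8, 9, 10, 11]"
  "[0..<14] = [0, 1, 2, 3, 4, 5, 6, 7, 8, 9, 10, 11, 12, 13]"
  "[0..<20] = [0, 1, 2, 3, 4, 5, 6, 7, 8, 9, 10, 11, 12, 13, 14, 15, 16, 17, 18, 19]"
  by code_simp+

lemma lessThan_12: "{..<12} = {0, 1, 2, 3, 4, 5, 6, 7, 8, 9, 10, 11 :: nat}"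
  using arg_cong[OF upt_simps(1), of set] by (simp add: lessThan_atLeast0)

lemma base_graph_ico: "base_graph ico_nbs ico_cliques" by code_simp

text \<open>The lists of stable sets were found by computer search.\<close>

definition moves_positive :: "nat list list list" where
  "moves_positive =
    [[[0, 2, 8], [1, 4, 7], [3, 6, 10], [5, 9, 11]]]"

lemma valid_moves_positive: "valid_moves ico_nbs moves_positive" by code_simp

text \<open>The only move is a partition of all twelve vertices into four stable sets. It lowers
  each closed neighbourhood by 6 and each triangle by 3, more than the required 8, and the bound
  itself gives \<open>k\<close> at least 5.\<close>

lemma not_stuck_positive:
  fixes k :: int
  assumes "w0 > 0" "w1 > 0" "w2 > 0" "w3 > 0" "w4 > 0" "w5 > 0" "w6 > 0" "w7 > 0" "w8 > 0" "w9 > 0" "w10 > 0" "w11 > 0"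
  shows "\<not> stuck ico_nbs ico_cliques
    [d0, d1, d2, d3, d4, d5, d6, d7, d8, d9, d10, d11]
    [q0, q1, q2, q3, q4, q5, q6, q7, q8, q9, q10, q11, q12, q13, q14, q15, q16, q17, q18, q19]
    [w0, w1, w2, w3, w4, w5, w6, w7, w8, w9, w10, w11] k moves_positive"
  by (insert assms, code_simp, simp only: list_connective_simps, intro impI notI, elim conjE, smt (z3))

definition moves_one_zero :: "nat list list list" where
  "moves_one_zero =
    [[[0, 2, 8], [1, 4, 7], [3, 6, 10], [5, 9]], [[2, 8], [1, 4, 7], [3, 6, 10], [5, 9]]]"

lemma valid_moves_one_zero: "valid_moves ico_nbs moves_one_zero" by code_simp

text \<open>The two moves serve for \<open>w0 > 0\<close> and \<open>w0 = 0\<close>. A vertex may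
  now lose only 5 from its closed neighbourhood and 2 from a triangle through a vertex of weight 0.
  The missing unit is slack, because the other triangle on the remaining edge is heavier.\<close>

lemma not_stuck_one_zero:
  fixes k :: int
  assumes "w1 > 0" "w2 > 0" "w3 > 0" "w4 > 0" "w5 > 0" "w6 > 0" "w7 > 0" "w8 > 0" "w9 > 0" "w10 > 0"
  shows "\<not> stuck ico_nbs ico_cliques
    [d0, d1, d2, d3, d4, d5, d6, d7, d8, d9, d10, d11]
    [q0, q1, q2, q3, q4, q5, q6, q7, q8, q9, q10, q11, q12, q13, q14, q15, q16, q17, q18, q19]
    [w0, w1, w2, w3, w4, w5, w6, w7, w8, w9, w10, 0] k moves_one_zero"
  by (insert assms, code_simp, simp only: list_connective_simps, intro impI notI, elim conjE, smt (z3))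

definition moves_adjacent_zeros :: "nat list list list" where
  "moves_adjacent_zeros =
    [[[1, 4, 7]], [[3, 6, 9]], [[1, 4, 8]], [[1, 5], [1, 7], [3, 7], [3, 9], [5, 9]],
     [[0, 4], [0, 6], [3, 6], [3, 7], [4, 7]], [[0, 6], [0, 8], [5, 8], [5, 9], [6, 9]],
     [[0, 2], [0, 4], [1, 4], [1, 5], [2, 5]]]"

lemma valid_moves_adjacent_zeros: "valid_moves ico_nbs moves_adjacent_zeros" by code_simp

text \<open>Each list of five pairs covers twice the pentagon of neighbours of one of 0, 3, 5, 7. A
  vertex of the pentagon loses 6 from its closed neighbourhood and 4 from a clique on a pentagon
  edge, exactly twice the five colours spent; other cliques need slack.\<close>

lemma not_stuck_adjacent_zeros:
  fixes k :: int
  assumes "w0 + w1 + w2 + w3 + w4 + w5 + w6 + w7 + w8 + w9 > 0"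
  shows "\<not> stuck ico_nbs ico_cliques
    [d0, d1, d2, d3, d4, d5, d6, d7, d8, d9, d10, d11]
    [q0, q1, q2, q3, q4, q5, q6, q7, q8, q9, q10, q11, q12, q13, q14, q15, q16, q17, q18, q19]
    [w0, w1, w2, w3, w4, w5, w6, w7, w8, w9, 0, 0] k moves_adjacent_zeros"
  by (insert assms, code_simp, simp only: list_connective_simps, intro impI notI, elim conjE, smt (z3))

definition moves_distant_zeros :: "nat list list list" where
  "moves_distant_zeros =
    [[[2, 5, 8]], [[3, 6, 10]], [[2, 6], [2, 8], [4, 8], [4, 10], [6, 10]]]"

lemma valid_moves_distant_zeros: "valid_moves ico_nbs moves_distant_zeros" by code_simp

text \<open>The vertices 9 and 11 are at distance two. The five pairs cover the pentagon around 11
  twice.\<close>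

lemma not_stuck_distant_zeros:
  fixes k :: int
  assumes "w2 > 0" "w4 > 0" "w6 > 0" "w8 > 0" "w10 > 0"
  shows "\<not> stuck ico_nbs ico_cliques
    [d0, d1, d2, d3, d4, d5, d6, d7, d8, d9, d10, d11]
    [q0, q1, q2, q3, q4, q5, q6, q7, q8, q9, q10, q11, q12, q13, q14, q15, q16, q17, q18, q19]
    [w0, w1, w2, w3, w4, w5, w6, w7, w8, 0, w10, 0] k moves_distant_zeros"
  by (insert assms, code_simp, simp only: list_connective_simps, intro impI notI, elim conjE, smt (z3))

text \<open>The indices 1 to 10 are shifted cyclically by \<open>j\<close>. An odd shift exchanges
  odd and even indices and hence must exchange 0 and 11.\<close>

definition rotation :: "nat \<Rightarrow> nat list" where
  "rotation j = (if even j then 0 else 11) # map (\<lambda>i. (i + j - 1) mod 10 + 1) [1..<11] @ [if even j then 11 else 0]"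

lemma automorphism_rotation: "j \<in> {..9} \<Longrightarrow> automorphism ico_nbs ico_cliques (rotation j) (rotation (10 - j))"
proof -
  have "\<forall>j\<in>{..9}. automorphism ico_nbs ico_cliques (rotation j) (rotation (10 - j))" by code_simp
  then show "j \<in> {..9} \<Longrightarrow> automorphism ico_nbs ico_cliques (rotation j) (rotation (10 - j))" by blast
qed

text \<open>A symmetry of order five that fixes 3 and 8 and maps 11 to 10. The shifts alone have two
  orbits, 0 and 11 on the one hand and 1 to 10 on the other; this map joins them.\<close>

lemma automorphism_flip:
  "automorphism ico_nbs ico_cliques [5, 0, 1, 3, 2, 4, 11, 6, 8, 7, 9, 10] [1, 2, 4, 3, 5, 0, 7, 9, 8, 10, 11, 6]"
  by code_simp

lemma gamma_colourable_ico_special: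
  assumes IH: "\<And>w'. sum w' {..<length ico_nbs} < sum w {..<length ico_nbs} \<Longrightarrow> gamma_colourable ico_nbs ico_cliques w'"
    and cases: "(\<forall>v<12. 0 < w v) \<or> w 11 = 0 \<and> (\<forall>v\<in>{1..10}. 0 < w v) \<or> w 11 = 0 \<and> w 10 = 0 \<or>
      w 11 = 0 \<and> w 9 = 0 \<and> (\<forall>v\<in>{2, 4, 6, 8, 10}. 0 < w v)"
  shows "gamma_colourable ico_nbs ico_cliques w"
  using cases
proof (elim disjE conjE)
  assume pos: "\<forall>v<12. 0 < w v"
  show ?thesis
    by (rule gamma_colourable_step[OF base_graph_ico _ valid_moves_positive], rule IH, assumption,
        unfold length_simps upt_simps list.map, rule not_stuck_positive) (simp_all add: pos)
next
  assume zero: "w 11 = 0" and pos: "\<forall>v\<in>{1..10}. 0 < w v"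
  show ?thesis
    by (rule gamma_colourable_step[OF base_graph_ico _ valid_moves_one_zero], rule IH, assumption,
        unfold length_simps upt_simps list.map zero of_nat_0, rule not_stuck_one_zero) (simp_all add: pos)
next
  assume zero: "w 11 = 0" "w 10 = 0"
  show ?thesis
    by (rule gamma_colourable_step[OF base_graph_ico _ valid_moves_adjacent_zeros], rule IH, assumption,
        unfold length_simps upt_simps list.map zero of_nat_0, rule not_stuck_adjacent_zeros)
      (auto simp: lessThan_12 zero)
next
  assume zero: "w 11 = 0" "w 9 = 0" and pos: "\<forall>v\<in>{2, 4, 6, 8, 10}. 0 < w v"
  show ?thesis
    by (rule gamma_colourable_step[OF base_graph_ico _ valid_moves_distant_zeros], rule IH, assumption,
        unfold length_simps upt_simps list.map zero of_nat_0, rule not_stuck_distant_zeros)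
      (simp_all add: pos)
qed

text \<open>Induction on the total weight, which automorphisms preserve. If some weight vanishes, a
  symmetry moves that zero to 11. A second zero among 1 to 10 is then moved to 10 if it is adjacent
  to 11, and otherwise to 9.\<close>

lemma gamma_colourable_ico: "gamma_colourable ico_nbs ico_cliques w"
proof (induction "sum w {..<length ico_nbs}" arbitrary: w rule: less_induct)
  case less
  have special: "gamma_colourable ico_nbs ico_cliques w'"
    if "sum w' {..<length ico_nbs} = sum w {..<length ico_nbs}"
      "(\<forall>v<12. 0 < w' v) \<or> w' 11 = 0 \<and> (\<forall>v\<in>{1..10}. 0 < w' v) \<or> w' 11 = 0 \<and> w' 10 = 0 \<or>
        w' 11 = 0 \<and> w' 9 = 0 \<and> (\<forall>v\<in>{2, 4, 6, 8, 10}. 0 < w' v)" for w'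
    using gamma_colourable_ico_special[OF _ that(2)] less that(1) by simp
  have rot: "rotation j ! 0 = (if even j then 0 else 11)" "rotation j ! 11 = (if even j then 11 else 0)"
    "i \<in> {1..10} \<Longrightarrow> rotation j ! i = (i + j - 1) mod 10 + 1" for i j
    by (auto simp: rotation_def nth_Cons' nth_append)
  have one: "gamma_colourable ico_nbs ico_cliques w'"
    if sum: "sum w' {..<length ico_nbs} = sum w {..<length ico_nbs}" and 11: "w' 11 = 0" for w'
  proof -
    have turn: "gamma_colourable ico_nbs ico_cliques w'"
      if "even j" "j \<le> 9" "gamma_colourable ico_nbs ico_cliques (\<lambda>v. w' (rotation j ! v))" for j
      using gamma_colourable_automorphism[OF base_graph_ico automorphism_rotation that(3)] that(2) by simp
    have sum': "sum (\<lambda>v. w' (rotation j ! v)) {..<length ico_nbs} = sum w {..<length ico_nbs}" if "j \<le> 9" for j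
      using sum_automorphism[OF automorphism_rotation, of j w'] sum that by simp
    consider (pos) "\<forall>v\<in>{1..10}. 0 < w' v" | (even) v where "v \<in> {2, 4, 6, 8, 10}" "w' v = 0"
      | (odd) v where "v \<in> {1, 3, 5, 7, 9}" "w' v = 0" "\<forall>v\<in>{2, 4, 6, 8, 10}. 0 < w' v"
    proof (cases "\<forall>v\<in>{1..10}. 0 < w' v")
      case False
      then obtain v where v: "v \<in> {1..10}" "w' v = 0" by auto
      have "{1..10} = {2, 4, 6, 8, 10} \<union> {1, 3, 5, 7, 9::nat}" by code_simp
      then show ?thesis using v that(2,3) by blast
    qed (use that(1) in blast)
    then show ?thesis
    proof cases
      case pos
      then show ?thesis using special[OF sum] 11 by blast
    next
      case even
      \<comment> \<open>This shift maps 10 to \<open>v\<close>; being even, it fixes 11.\<close>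
      define j where "j = v mod 10"
      have j: "even j" "j \<le> 9" "rotation j ! 10 = v" "rotation j ! 11 = 11"
        using even(1) unfolding j_def by (auto simp: rot)
      show ?thesis
        by (rule turn[OF j(1,2)], rule special[OF sum'[OF j(2)]]) (simp add: j even 11)
    next
      case odd
      \<comment> \<open>This shift maps 9 to \<open>v\<close>, fixes 11 and keeps even vertices
        even.\<close>
      define j where "j = (v + 1) mod 10"
      have j: "even j" "j \<le> 9" "rotation j ! 9 = v" "rotation j ! 11 = 11"
        "\<forall>u\<in>{2, 4, 6, 8, 10}. rotation j ! u \<in> {2, 4, 6, 8, 10}"
        using odd(1) unfolding j_def by (auto simp: rot)
      have "\<forall>u\<in>{2, 4, 6, 8, 10}. 0 < w' (rotation j ! u)" using j(5) odd(3) by blast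
      then show ?thesis
        by (intro turn[OF j(1,2)] special[OF sum'[OF j(2)]] disjI2 conjI) (simp_all only: j(3,4) odd(2) 11)
    qed
  qed
  show ?case
  proof (cases "\<forall>v<12. 0 < w v")
    case False
    then obtain v where v: "v < 12" "w v = 0" by auto
    have flip: "gamma_colourable ico_nbs ico_cliques w'"
      if "sum w' {..<length ico_nbs} = sum w {..<length ico_nbs}" "w' 10 = 0" for w'
      by (rule gamma_colourable_automorphism[OF base_graph_ico automorphism_flip], rule one)
        (use sum_automorphism[OF automorphism_flip, of w'] that in simp_all)
    \<comment> \<open>A rotation can place a zero at 10 or at 11; in the first case
      \<open>flip\<close> moves it on to 11.\<close>
    have turn: "gamma_colourable ico_nbs ico_cliques w"
      if "j \<le> 9" "w (rotation j ! 10) = 0 \<or> w (rotation j ! 11) = 0" for j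
      using that one[of "\<lambda>v. w (rotation j ! v)"] flip[of "\<lambda>v. w (rotation j ! v)"]
        gamma_colourable_automorphism[OF base_graph_ico automorphism_rotation, of j w]
        sum_automorphism[OF automorphism_rotation, of j w] by auto
    consider "v = 0" | "v = 11" | "v \<in> {1..10}" using v(1) by fastforce
    then show ?thesis
    proof cases
      case 1
      then show ?thesis using turn[of 1] v(2) by (simp add: rot)
    next
      case 2
      then show ?thesis using one v(2) by simp
    next
      case 3
      then have "rotation (v mod 10) ! 10 = v" by (simp add: rot) presburger
      then show ?thesis using turn[of "v mod 10"] v(2) by simp
    qed
  qed (use special in blast)
qed

section \<open>The graph with split vertices\<close>

lemma base_graph_fuzzy: "base_graph fuzzy_nbs fuzzy_cliques" by code_simp

text \<open>The names refer to the edges between the support of 1, 10 and that of 4, 11, and then likewise for 6, 12 and 9, 13.\<close>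

definition moves_complete_complete :: "nat list list list" where
  "moves_complete_complete =
    [[[1, 6]], [[3, 7]], [[1, 5]], [[0, 6]], [[4, 9]], [[3, 6], [5, 9]], [[0, 4], [1, 7]]]"

lemma valid_moves_complete_complete: "valid_moves fuzzy_nbs moves_complete_complete" by code_simp

lemma not_stuck_complete_complete:
  fixes k :: int
  assumes "w1 > 0" "w4 > 0" "w6 > 0" "w9 > 0"
  shows "\<not> stuck fuzzy_nbs fuzzy_cliques
    [d0, d1, d2, d3, d4, d5, d6, d7, d8, d9, d10, d11, d12, d13]
    [q0, q1, q2, q3, q4, q5, q6, q7, q8, q9, q10, q11, q12, q13]
    [w0, w1, w2, w3, w4, w5, w6, w7, w8, w9, 0, 0, 0, 0] k moves_complete_complete"
  by (insert assms, code_simp, simp only: list_connective_simps, intro impI notI, elim conjE, smt (z3))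

definition moves_complete_empty :: "nat list list list" where
  "moves_complete_empty =
    [[[0, 4, 8]], [[1, 5]], [[1, 7], [4, 7], [4, 9]], [[1, 7], [4, 8], [4, 9]],
     [[1, 12], [1, 7], [4, 7], [4, 9], [9, 12]], [[1, 12], [1, 8], [4, 8], [4, 9], [9, 12]],
     [[1, 5], [1, 7], [4, 7], [4, 9], [5, 9]], [[1, 5], [1, 7], [3, 7], [4, 9], [5, 9]],
     [[0, 4], [0, 12], [1, 7], [3, 12], [4, 7]], [[0, 4], [0, 12], [1, 12], [1, 7], [4, 7]]]"

lemma valid_moves_complete_empty: "valid_moves fuzzy_nbs moves_complete_empty" by code_simp

lemma not_stuck_complete_empty:
  fixes k :: int
  assumes "w1 > 0" "w4 > 0"
  shows "\<not> stuck fuzzy_nbs fuzzy_cliques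
    [d0, d1, d2, d3, d4, d5, d6, d7, d8, d9, d10, d11, d12, d13]
    [q0, q1, q2, q3, q4, q5, q6, q7, q8, q9, q10, q11, q12, q13]
    [w0, w1, w2, w3, w4, w5, 0, w7, w8, w9, 0, 0, w12, 0] k moves_complete_empty"
  by (insert assms, code_simp, simp only: list_connective_simps, intro impI notI, elim conjE, smt (z3))

definition moves_partial :: "nat list list list" where
  "moves_partial =
    [[[1, 6]], [[3, 12, 13]], [[5, 9]], [[3, 9, 12]], [[4, 10]], [[0, 4]], [[1, 7, 11]], [[1, 5]],
     [[1, 8, 11]], [[4, 9]], [[0, 6]], [[3, 6, 13]], [[4, 7, 10]], [[3, 6], [3, 9]]]"

lemma valid_moves_partial: "valid_moves fuzzy_nbs moves_partial" by code_simp

lemma not_stuck_partial: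
  fixes k :: int
  assumes "w1 > 0" "w4 > 0" "w10 + w11 > 0"
  shows "\<not> stuck fuzzy_nbs fuzzy_cliques
    [d0, d1, d2, d3, d4, d5, d6, d7, d8, d9, d10, d11, d12, d13]
    [q0, q1, q2, q3, q4, q5, q6, q7, q8, q9, q10, q11, q12, q13]
    [w0, w1, w2, w3, w4, w5, w6, w7, w8, w9, w10, w11, w12, w13] k moves_partial"
  by (insert assms, code_simp, simp only: list_connective_simps, intro impI notI, elim conjE, smt (z3))

text \<open>The reflection that fixes 0 and sends \<open>i\<close> to \<open>10 - i\<close> for
  \<open>i\<close> from 1 to 9. It exchanges the two matched pairs together with their
  twins.\<close>

lemma automorphism_reflection:
  "automorphism fuzzy_nbs fuzzy_cliques [0, 9, 8, 7, 6, 5, 4, 3, 2, 1, 13, 12, 11, 10] [0, 9, 8, 7, 6, 5, 4, 3, 2, 1, 13, 12, 11, 10]"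
  by code_simp

text \<open>Merges 6 into its twin 12, and 13 into its twin 9, at the cost of the edge between 6 and
  9.\<close>

lemma pushes_merge:
  "pushes fuzzy_nbs fuzzy_cliques fuzzy_nbs fuzzy_cliques [0, 1, 2, 3, 4, 5, 12, 7, 8, 9, 10, 11, 12, 9] [(6, 9), (9, 6)]"
  by code_simp

text \<open>Merging each twin with its original leads into the icosahedron, with 10 and 11
  unoccupied, at the cost of the edges of both matched pairs.\<close>

lemma pushes_ico:
  "pushes fuzzy_nbs fuzzy_cliques ico_nbs ico_cliques [0, 1, 2, 3, 4, 5, 6, 7, 8, 9, 1, 4, 6, 9]
     [(1, 4), (4, 1), (6, 9), (9, 6)]"
  by code_simp

lemma gamma_colourable_fuzzy_special:
  assumes IH: "\<And>w'. sum w' {..<length fuzzy_nbs} < sum w {..<length fuzzy_nbs} \<Longrightarrow> gamma_colourable fuzzy_nbs fuzzy_cliques w'"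
    and pos: "0 < w 1" "0 < w 4"
    and cases: "0 < w 10 + w 11 \<or> w 10 = 0 \<and> w 11 = 0 \<and> w 12 = 0 \<and> w 13 = 0 \<and> 0 < w 6 \<and> 0 < w 9 \<or>
      w 10 = 0 \<and> w 11 = 0 \<and> w 6 = 0 \<and> w 13 = 0"
  shows "gamma_colourable fuzzy_nbs fuzzy_cliques w"
  using cases
proof (elim disjE conjE)
  assume pos': "0 < w 10 + w 11"
  show ?thesis
    by (rule gamma_colourable_step[OF base_graph_fuzzy _ valid_moves_partial], rule IH, assumption,
        unfold length_simps upt_simps list.map, rule not_stuck_partial) (use pos pos' in linarith)+
next
  assume zero: "w 10 = 0" "w 11 = 0" "w 12 = 0" "w 13 = 0" and pos': "0 < w 6" "0 < w 9"
  show ?thesis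
    by (rule gamma_colourable_step[OF base_graph_fuzzy _ valid_moves_complete_complete], rule IH, assumption,
        unfold length_simps upt_simps list.map zero of_nat_0, rule not_stuck_complete_complete) (use pos pos' in linarith)+
next
  assume zero: "w 10 = 0" "w 11 = 0" "w 6 = 0" "w 13 = 0"
  show ?thesis
    by (rule gamma_colourable_step[OF base_graph_fuzzy _ valid_moves_complete_empty], rule IH, assumption,
        unfold length_simps upt_simps list.map zero of_nat_0, rule not_stuck_complete_empty) (use pos in linarith)+
qed

text \<open>If neither pair has an edge, merging reduces to the icosahedron. Otherwise 1 and 4 have
  positive weight up to reflection. Then reflecting a partially joined second pair into first place,
  or merging the twins of an edgeless second pair, leads to a pattern of
  \<open>gamma_colourable_fuzzy_special\<close>.\<close>

lemma gamma_colourable_fuzzy: "gamma_colourable fuzzy_nbs fuzzy_cliques w"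
proof (induction "sum w {..<length fuzzy_nbs}" arbitrary: w rule: less_induct)
  case less
  let ?r = "[0, 9, 8, 7, 6, 5, 4, 3, 2, 1, 13, 12, 11, 10] :: nat list"
  let ?m = "[0, 1, 2, 3, 4, 5, 12, 7, 8, 9, 10, 11, 12, 9] :: nat list"
  have special: "gamma_colourable fuzzy_nbs fuzzy_cliques w'"
    if "sum w' {..<length fuzzy_nbs} = sum w {..<length fuzzy_nbs}" "0 < w' 1" "0 < w' 4"
      "0 < w' 10 + w' 11 \<or> w' 10 = 0 \<and> w' 11 = 0 \<and> w' 12 = 0 \<and> w' 13 = 0 \<and> 0 < w' 6 \<and> 0 < w' 9 \<or>
      w' 10 = 0 \<and> w' 11 = 0 \<and> w' 6 = 0 \<and> w' 13 = 0" for w'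
    using gamma_colourable_fuzzy_special[OF _ that(2-)] less that(1) by simp
  have reflect: "gamma_colourable fuzzy_nbs fuzzy_cliques w'"
    if "gamma_colourable fuzzy_nbs fuzzy_cliques (\<lambda>v. w' (?r ! v))" for w'
    by (rule gamma_colourable_automorphism[OF base_graph_fuzzy automorphism_reflection that])
  have sum_reflect: "sum (\<lambda>v. w' (?r ! v)) {..<length fuzzy_nbs} = sum w' {..<length fuzzy_nbs}" for w' :: "nat \<Rightarrow> nat"
    by (rule sum_automorphism[OF automorphism_reflection])
  have half: "gamma_colourable fuzzy_nbs fuzzy_cliques w'"
    if sum: "sum w' {..<length fuzzy_nbs} = sum w {..<length fuzzy_nbs}" and pos: "0 < w' 1" "0 < w' 4" for w'
  proof -
    consider (partial) "0 < w' 10 + w' 11" | (partial') "0 < w' 6" "0 < w' 9" "0 < w' 12 + w' 13"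
      | (complete) "w' 10 = 0" "w' 11 = 0" "w' 12 = 0" "w' 13 = 0" "0 < w' 6" "0 < w' 9"
      | (empty) "w' 10 = 0" "w' 11 = 0" "w' 6 = 0 \<or> w' 9 = 0" by linarith
    then show ?thesis
    proof cases
      case partial
      then show ?thesis using special[OF sum pos] by blast
    next
      case partial'
      show ?thesis
        by (rule reflect, rule special) (use partial' sum_reflect[of w'] sum in auto)
    next
      case complete
      then show ?thesis using special[OF sum pos] by blast
    next
      case empty
      \<comment> \<open>After merging, 12 and 9 carry the whole second pair, while 6 and 13 have
        weight 0.\<close>
      have push: "push fuzzy_nbs ?m w' i = sum_list (map w' (filter (\<lambda>u. ?m ! u = i) [0, 1, 2, 3, 4, 5, 6, 7, 8, 9, 10, 11, 12, 13]))" for i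
        unfolding push_eq length_simps upt_simps ..
      show ?thesis
      proof (rule gamma_colourable_push[OF base_graph_fuzzy base_graph_fuzzy pushes_merge], goal_cases)
        case 2
        show ?case
        proof (rule special)
          show "sum (push fuzzy_nbs ?m w') {..<length fuzzy_nbs} = sum w {..<length fuzzy_nbs}"
            unfolding sum[symmetric] by (rule sum_push[OF pushes_merge])
        qed (unfold push, use pos empty in auto)
      qed (use empty in auto)
    qed
  qed
  consider "0 < w 1" "0 < w 4" | "0 < w 6" "0 < w 9" | "w 1 = 0 \<or> w 4 = 0" "w 6 = 0 \<or> w 9 = 0" by linarith
  then show ?case
  proof cases
    case 1
    then show ?thesis using half by blast
  next
    case 2
    show ?thesis by (rule reflect, rule half) (use 2 sum_reflect[of w] in simp_all)
  next
    case 3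
    show ?thesis
      by (rule gamma_colourable_push[OF base_graph_fuzzy base_graph_ico pushes_ico _ gamma_colourable_ico]) (use 3 in auto)
  qed
qed

section \<open>Rearranging the colours of two cliques\<close>

definition bip_cover :: "('a \<times> 'b) set \<Rightarrow> 'a set \<Rightarrow> 'b set \<Rightarrow> bool" where
  "bip_cover E C D \<longleftrightarrow> finite C \<and> finite D \<and> (\<forall>(a, b)\<in>E. a \<in> C \<or> b \<in> D)"

text \<open>If two edges \<open>e\<close> and \<open>f\<close> of an edge-critical graph share a vertex \<open>x\<close>, then small covers of \<open>E - {e}\<close> and
  \<open>E - {f}\<close> can be crossed: union on one side and intersection on the other.  This covers \<open>E\<close>, in one of the two
  cases after adding \<open>x\<close>, and one of the two covers is too small.\<close>

lemma critical_inj_fst: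
  assumes min: "\<And>C D. bip_cover E C D \<Longrightarrow> r \<le> card C + card D"
    and crit: "\<And>e. e \<in> E \<Longrightarrow> \<exists>C D. bip_cover (E - {e}) C D \<and> card C + card D < r"
  shows "inj_on fst E"
proof (rule inj_onI, rule ccontr)
  fix e f assume ef: "e \<in> E" "f \<in> E" "fst e = fst f" "e \<noteq> f"
  define x y1 y2 where "x = fst e" and "y1 = snd e" and "y2 = snd f"
  have e: "e = (x, y1)" and f: "f = (x, y2)" by (simp add: x_def y1_def, simp add: x_def y2_def ef(3))
  obtain C1 D1 where 1: "bip_cover (E - {e}) C1 D1" "card C1 + card D1 < r" using crit[OF ef(1)] by blast
  obtain C2 D2 where 2: "bip_cover (E - {f}) C2 D2" "card C2 + card D2 < r" using crit[OF ef(2)] by blast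
  have fin: "finite C1" "finite D1" "finite C2" "finite D2" using 1(1) 2(1) by (auto simp: bip_cover_def)
  have "\<not> bip_cover E C1 D1" "\<not> bip_cover E C2 D2" using min 1(2) 2(2) by fastforce+
  then have "x \<notin> C1" "x \<notin> C2" using 1(1) 2(1) e f by (auto simp: bip_cover_def)
  then have y: "y2 \<in> D1" "y1 \<in> D2" using 1(1) 2(1) ef e f by (auto simp: bip_cover_def)
  have "bip_cover E (C1 \<inter> C2) (D1 \<union> D2)"
    using 1(1) 2(1) y e f unfolding bip_cover_def by fastforce
  moreover have "bip_cover E (insert x (C1 \<union> C2)) (D1 \<inter> D2)"
    using 1(1) 2(1) e f unfolding bip_cover_def by fastforce
  ultimately have "r \<le> card (C1 \<inter> C2) + card (D1 \<union> D2)" "r \<le> Suc (card (C1 \<union> C2)) + card (D1 \<inter> D2)"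
    using min[of "C1 \<inter> C2" "D1 \<union> D2"] min[of "insert x (C1 \<union> C2)" "D1 \<inter> D2"] \<open>x \<notin> C1\<close> \<open>x \<notin> C2\<close> fin by auto
  then show False
    using card_Un_Int[OF fin(1,3)] card_Un_Int[OF fin(2,4)] 1(2) 2(2) by linarith
qed

text \<open>An edge whose deletion keeps the cover number \<open>r\<close> is deleted, and induction
  applies. If there is none, \<open>critical_inj_fst\<close> for both sides shows that
  \<open>E\<close> is itself a matching, and its first coordinates form a cover of the same
  size.\<close>

theorem koenig:
  fixes E :: "('a \<times> 'b) set"
  assumes "finite E"
  shows "\<exists>M C D. M \<subseteq> E \<and> inj_on fst M \<and> inj_on snd M \<and> bip_cover E C D \<and> card C + card D \<le> card M"
  using assms
proof (induction "card E" arbitrary: E rule: less_induct)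
  case less
  define r where "r = (LEAST n. \<exists>C D. bip_cover E C D \<and> card C + card D = n)"
  have all: "bip_cover E (fst ` E) {}" using less.prems by (force simp: bip_cover_def)
  then have "\<exists>C D. bip_cover E C D \<and> card C + card D = r"
    unfolding r_def by (intro LeastI_ex[of "\<lambda>n. \<exists>C D. bip_cover E C D \<and> card C + card D = n"]) blast
  then obtain C0 D0 where cov: "bip_cover E C0 D0" "card C0 + card D0 = r" by blast
  have min: "r \<le> card C + card D" if "bip_cover E C D" for C D
    unfolding r_def by (rule Least_le) (use that in blast)
  show ?case
  proof (cases "\<exists>e\<in>E. \<forall>C D. bip_cover (E - {e}) C D \<longrightarrow> r \<le> card C + card D")
    case True
    then obtain e where e: "e \<in> E" "\<And>C D. bip_cover (E - {e}) C D \<Longrightarrow> r \<le> card C + card D" by blast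
    have lt: "card (E - {e}) < card E" by (rule card_Diff1_less[OF less.prems e(1)])
    obtain M C D where M: "M \<subseteq> E - {e}" "inj_on fst M" "inj_on snd M" "bip_cover (E - {e}) C D"
      "card C + card D \<le> card M" using less.hyps[OF lt finite_Diff[OF less.prems]] by blast
    then have "card C0 + card D0 \<le> card M" using cov(2) e(2)[OF M(4)] by linarith
    then show ?thesis using M(1-3) cov(1) by blast
  next
    case False
    then have crit: "\<exists>C D. bip_cover (E - {e}) C D \<and> card C + card D < r" if "e \<in> E" for e
      using that False by (meson not_le)
    have swap: "bip_cover (prod.swap ` F) C D \<longleftrightarrow> bip_cover F D C" for F :: "('a \<times> 'b) set" and C D
      by (auto simp: bip_cover_def)
    have "inj_on fst E" by (rule critical_inj_fst[OF min crit])
    have "inj_on fst (prod.swap ` E)"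
    proof (rule critical_inj_fst)
      show "r \<le> card C + card D" if "bip_cover (prod.swap ` E) C D" for C D
        using min[of D C] that swap by (simp add: add.commute)
      show "\<exists>C D. bip_cover (prod.swap ` E - {e}) C D \<and> card C + card D < r" if e: "e \<in> prod.swap ` E" for e
      proof -
        obtain e' where e': "e' \<in> E" "e = prod.swap e'" using e by blast
        obtain C D where "bip_cover (E - {e'}) C D" "card C + card D < r" using crit[OF e'(1)] by blast
        moreover have "prod.swap ` E - {e} = prod.swap ` (E - {e'})" using e'(2) by (auto simp: prod.swap_def)
        ultimately show ?thesis using swap[of "E - {e'}" D C] by (metis add.commute)
      qed
    qed
    then have "inj_on snd E" unfolding inj_on_def by (fastforce simp: prod_eq_iff)
    have "card (fst ` E) + card ({} :: 'b set) \<le> card E"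
      using card_image_le[OF less.prems, of fst] by simp
    then show ?thesis using all \<open>inj_on fst E\<close> \<open>inj_on snd E\<close> by blast
  qed
qed

lemma extend_to_bij:
  assumes "finite A" "finite X" "card A = card X" "A' \<subseteq> A" "inj_on t A'" "t ` A' \<subseteq> X"
  shows "\<exists>h. bij_betw h A X \<and> (\<forall>a\<in>A'. h a = t a)"
proof -
  have fin: "finite A'" using assms(1,4) by (rule rev_finite_subset)
  have "card (A - A') = card (X - t ` A')"
    using assms fin by (simp add: card_Diff_subset card_image)
  then obtain h where h: "bij_betw h (A - A') (X - t ` A')"
    using finite_same_card_bij[of "A - A'" "X - t ` A'"] assms(1,2) by auto
  have "bij_betw (\<lambda>a. if a \<in> A' then t a else h a) (A' \<union> (A - A')) (t ` A' \<union> (X - t ` A'))"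
    by (rule bij_betw_disjoint_Un) (use h assms(5) in \<open>auto simp: bij_betw_def\<close>)
  moreover have "A' \<union> (A - A') = A" "t ` A' \<union> (X - t ` A') = X" using assms(4,6) by auto
  ultimately show ?thesis by (intro exI[of _ "\<lambda>a. if a \<in> A' then t a else h a"]) simp
qed

text \<open>The colours shared by \<open>A\<close> and \<open>B\<close> are assigned to distinct
  pairs of \<open>M\<close>, both ends of such a pair receive its colour, and the rest is filled up
  to bijections onto the old colour sets. No further colour can then be shared.\<close>

lemma recolour_pair:
  fixes f :: "'a \<Rightarrow> nat"
  assumes fin: "finite A" "finite B" and inj: "inj_on f A" "inj_on f B"
    and M: "M \<subseteq> A \<times> B" "inj_on fst M" "inj_on snd M" "card (f ` A \<inter> f ` B) \<le> card M"
  shows "\<exists>hA hB. bij_betw hA A (f ` A) \<and> bij_betw hB B (f ` B) \<and> (\<forall>a\<in>A. \<forall>b\<in>B. hA a = hB b \<longrightarrow> (a, b) \<in> M)"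
proof -
  let ?S = "f ` A \<inter> f ` B"
  obtain M' where M': "M' \<subseteq> M" "card M' = card ?S" "finite M'"
    by (rule obtain_subset_with_card_n[OF M(4)])
  obtain t where t: "bij_betw t M' ?S"
    using finite_same_card_bij[of M' ?S] M'(2,3) fin by auto
  have inj': "inj_on fst M'" "inj_on snd M'" using M(2,3) M'(1) by (auto intro: inj_on_subset)
  have sub: "fst ` M' \<subseteq> A" "snd ` M' \<subseteq> B" using M(1) M'(1) by auto
  \<comment> \<open>The projection \<open>p\<close> will be \<open>fst\<close> for \<open>A\<close>
    and \<open>snd\<close> for \<open>B\<close>.\<close>
  have ext: "\<exists>h. bij_betw h X (f ` X) \<and> (\<forall>m\<in>M'. h (p m) = t m)"
    if p: "inj_on p M'" "p ` M' \<subseteq> X" and X: "finite X" "inj_on f X" "?S \<subseteq> f ` X" for p and X :: "'a set"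
  proof -
    have "inj_on (t \<circ> inv_into M' p) (p ` M')"
      using t p by (intro comp_inj_on inj_on_inv_into) (auto simp: bij_betw_def intro: inj_on_subset)
    moreover have "(t \<circ> inv_into M' p) ` p ` M' \<subseteq> f ` X"
      using t p X(3) by (auto simp: bij_betw_def image_image)
    ultimately obtain h where "bij_betw h X (f ` X)" "\<forall>a\<in>p ` M'. h a = (t \<circ> inv_into M' p) a"
      using extend_to_bij[of X "f ` X" "p ` M'" "t \<circ> inv_into M' p"] p X by (auto simp: card_image)
    then show ?thesis using p(1) by (intro exI[of _ h]) auto
  qed
  obtain hA where hA: "bij_betw hA A (f ` A)" "\<forall>m\<in>M'. hA (fst m) = t m"
    using ext[OF inj'(1) sub(1) fin(1) inj(1)] by blast
  obtain hB where hB: "bij_betw hB B (f ` B)" "\<forall>m\<in>M'. hB (snd m) = t m"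
    using ext[OF inj'(2) sub(2) fin(2) inj(2)] by blast
  have "(a, b) \<in> M" if ab: "a \<in> A" "b \<in> B" "hA a = hB b" for a b
  proof -
    have "hA a \<in> ?S" using hA(1) hB(1) ab by (metis IntI bij_betwE)
    then obtain m where m: "m \<in> M'" "t m = hA a" using t by (metis bij_betw_imp_surj_on imageE)
    have "fst m = a" using hA m ab(1) sub(1) by (metis bij_betw_imp_inj_on image_subset_iff inj_onD)
    moreover have "snd m = b" using hB m ab(2,3) sub(2) by (metis bij_betw_imp_inj_on image_subset_iff inj_onD)
    ultimately show ?thesis using m(1) M'(1) by (metis prod.collapse subsetD)
  qed
  then show ?thesis using hA(1) hB(1) by blast
qed

text \<open>\<open>E'\<close> is the graph already coloured, \<open>E\<close> the target; only
  between \<open>A\<close> and \<open>B\<close> can \<open>E\<close> have edges missing from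
  \<open>E'\<close>. Two vertices of \<open>A\<close> and \<open>B\<close> with a common colour are
  not joined in \<open>E'\<close>, so one of them is in \<open>C\<close>. Hence at most
  \<open>card M\<close> colours are shared, and \<open>recolour_pair\<close> moves these to
  non-edges of \<open>E\<close>. An outside vertex with an \<open>E\<close>-neighbour in one clique
  is \<open>E'\<close>-adjacent to that whole clique, so permuting the colours there does no
  harm.\<close>

lemma recolour_homogeneous_pair:
  fixes f :: "'a \<Rightarrow> nat" and E E' :: "'a \<Rightarrow> 'a \<Rightarrow> bool"
  assumes fin: "finite V" and AB: "A \<subseteq> V" "B \<subseteq> V" "A \<inter> B = {}"
    and sym: "\<And>x y. x \<in> V \<Longrightarrow> y \<in> V \<Longrightarrow> E x y \<Longrightarrow> x \<noteq> y \<and> E y x"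
    and f: "\<And>x y. x \<in> V \<Longrightarrow> y \<in> V \<Longrightarrow> E' x y \<Longrightarrow> f x \<noteq> f y"
    and clique: "\<And>x y. x \<in> A \<and> y \<in> A \<or> x \<in> B \<and> y \<in> B \<Longrightarrow> x \<noteq> y \<Longrightarrow> E' x y"
    and hom: "\<And>x a a'. x \<in> V - (A \<union> B) \<Longrightarrow> a \<in> A \<and> a' \<in> A \<or> a \<in> B \<and> a' \<in> B \<Longrightarrow> E x a \<Longrightarrow> E' x a'"
    and out: "\<And>x y. x \<in> V - (A \<union> B) \<Longrightarrow> y \<in> V - (A \<union> B) \<Longrightarrow> E x y \<Longrightarrow> E' x y"
    and M: "M \<subseteq> A \<times> B" "inj_on fst M" "inj_on snd M" "\<And>a b. (a, b) \<in> M \<Longrightarrow> \<not> E a b"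
    and C: "finite C" "card C \<le> card M" "\<And>a b. a \<in> A \<Longrightarrow> b \<in> B \<Longrightarrow> a \<notin> C \<Longrightarrow> b \<notin> C \<Longrightarrow> E' a b"
  shows "\<exists>g. g ` V \<subseteq> f ` V \<and> (\<forall>x\<in>V. \<forall>y\<in>V. E x y \<longrightarrow> g x \<noteq> g y)"
proof -
  have finAB: "finite A" "finite B" using fin AB by (auto intro: finite_subset)
  have inj: "inj_on f A" "inj_on f B" using f clique AB by (meson inj_onI subsetD)+
  have "f ` A \<inter> f ` B \<subseteq> f ` C"
  proof
    fix s assume "s \<in> f ` A \<inter> f ` B"
    then obtain a b where ab: "a \<in> A" "b \<in> B" "s = f a" "s = f b" by blast
    then have "\<not> E' a b" using f AB by (metis subsetD)
    then have "a \<in> C \<or> b \<in> C" using C(3) ab by blast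
    then show "s \<in> f ` C" using ab by blast
  qed
  then have "card (f ` A \<inter> f ` B) \<le> card M"
    using C(1,2) card_image_le[OF C(1), of f] card_mono[of "f ` C"] by (meson finite_imageI le_trans)
  then obtain hA hB where h: "bij_betw hA A (f ` A)" "bij_betw hB B (f ` B)"
    "\<And>a b. a \<in> A \<Longrightarrow> b \<in> B \<Longrightarrow> hA a = hB b \<Longrightarrow> (a, b) \<in> M"
    using recolour_pair[OF finAB inj M(1-3)] by blast
  define g where "g x = (if x \<in> A then hA x else if x \<in> B then hB x else f x)" for x
  have gA: "g x = hA x" if "x \<in> A" for x using that by (simp add: g_def)
  have gB: "g x = hB x" if "x \<in> B" for x using that AB(3) by (auto simp: g_def)
  have gO: "g x = f x" if "x \<notin> A \<union> B" for x using that by (simp add: g_def)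
  have img: "\<exists>a'\<in>A. g a = f a'" if "a \<in> A" for a using gA[OF that] h(1) that by (metis bij_betwE imageE)
  have img': "\<exists>b'\<in>B. g b = f b'" if "b \<in> B" for b using gB[OF that] h(2) that by (metis bij_betwE imageE)
  have "g x \<in> f ` V" if "x \<in> V" for x
    using img[of x] img'[of x] gO[of x] that AB by (cases "x \<in> A"; cases "x \<in> B") auto
  moreover have mixed: "g x \<noteq> g a" if x: "x \<in> V - (A \<union> B)" and a: "a \<in> A \<union> B" "E x a" for x a
  proof -
    obtain a' where a': "a \<in> A \<and> a' \<in> A \<or> a \<in> B \<and> a' \<in> B" "g a = f a'" using img img' a(1) by blast
    then have "E' x a'" using hom x a(2) by blast
    then show ?thesis using f[of x a'] x a' AB gO[of x] by auto
  qed
  have "g x \<noteq> g y" if xy: "x \<in> V" "y \<in> V" "E x y" for x y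
  proof -
    have yx: "x \<noteq> y" "E y x" using sym xy by blast+
    consider "x \<notin> A \<union> B" "y \<notin> A \<union> B" | "x \<notin> A \<union> B" "y \<in> A \<union> B" | "x \<in> A \<union> B" "y \<notin> A \<union> B"
      | "x \<in> A" "y \<in> A" | "x \<in> B" "y \<in> B" | "x \<in> A" "y \<in> B" | "x \<in> B" "y \<in> A" by blast
    then show ?thesis
    proof cases
      case 1
      then show ?thesis using f[of x y] out xy gO by simp
    next
      case 2
      then show ?thesis using mixed xy by blast
    next
      case 3
      then show ?thesis using mixed[of y x] xy yx by (metis DiffI)
    next
      case 4
      then show ?thesis using h(1) yx gA by (metis bij_betw_imp_inj_on inj_onD)
    next
      case 5
      then show ?thesis using h(2) yx gB by (metis bij_betw_imp_inj_on inj_onD)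
    next
      case 6
      then show ?thesis using h(3)[of x y] M(4) xy gA gB by metis
    next
      case 7
      then show ?thesis using h(3)[of y x] M(4) yx gA gB by metis
    qed
  qed
  ultimately show ?thesis by blast
qed

section \<open>Thickenings\<close>

text \<open>For irreflexive \<open>E\<close> the first cardinality is the degree plus one. Thus the
  maximum in the theorem is at most \<open>k\<close>, expressed without ceilings or largest
  cliques.\<close>

definition locally_bounded :: "'a set \<Rightarrow> ('a \<Rightarrow> 'a \<Rightarrow> bool) \<Rightarrow> nat \<Rightarrow> bool" where
  "locally_bounded V E k \<longleftrightarrow> (\<forall>x\<in>V. \<forall>C\<subseteq>V. x \<in> C \<longrightarrow> (\<forall>y\<in>C. \<forall>z\<in>C. y \<noteq> z \<longrightarrow> E y z) \<longrightarrow>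
     card {y \<in> V. y = x \<or> E x y} + card C \<le> 2 * k)"

lemma wsum_fibre_card:
  assumes "finite V" "distinct xs"
  shows "wsum (\<lambda>i. card {x \<in> V. l x = i}) xs = card {x \<in> V. l x \<in> set xs}"
proof -
  have "card {x \<in> V. l x \<in> set xs} = (\<Sum>x\<in>{x \<in> V. l x \<in> set xs}. 1)" by simp
  also have "\<dots> = (\<Sum>i\<in>set xs. \<Sum>x\<in>{x \<in> {x \<in> V. l x \<in> set xs}. l x = i}. 1)"
    by (rule sum.group[symmetric]) (use assms(1) in auto)
  also have "\<dots> = (\<Sum>i\<in>set xs. card {x \<in> V. l x = i})"
    by (intro sum.cong refl) (auto intro!: arg_cong[of _ _ card])
  finally show ?thesis using assms(2) by (simp add: wsum_eq_sum)
qed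

text \<open>\<open>E\<close> may have more edges than the blow-up given by the labels; degrees and
  cliques of the blow-up are then no larger, so the bound for \<open>E\<close> suffices. The weights
  are the sizes of the label classes. Classes may be empty, which admits induced subgraphs.\<close>

lemma blow_up_colourable:
  assumes bg: "base_graph nb cl" and gamma_colourable: "\<And>w. gamma_colourable nb cl w" and V: "finite V"
    and l: "\<And>x. x \<in> V \<Longrightarrow> l x < length nb"
    and E: "\<And>x y. x \<in> V \<Longrightarrow> y \<in> V \<Longrightarrow> x \<noteq> y \<Longrightarrow> l x = l y \<or> l y \<in> set (nb ! l x) \<Longrightarrow> E x y"
    and k: "locally_bounded V E k"
  shows "\<exists>f. f ` V \<subseteq> {..<k} \<and> (\<forall>x\<in>V. \<forall>y\<in>V. x \<noteq> y \<longrightarrow> l x = l y \<or> l y \<in> set (nb ! l x) \<longrightarrow> f x \<noteq> f y)"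
proof -
  define w where "w i = card {x \<in> V. l x = i}" for i
  have "gamma_le nb cl k w"
    unfolding gamma_le_def
  proof (intro ballI impI)
    fix K v assume K: "K \<in> set cl" "v \<in> set K" and "0 < w v"
    then obtain x where x: "x \<in> V" "l x = v" unfolding w_def by (auto simp: card_gt_0_iff)
    note v = base_graphD(5)[OF bg K]
    let ?C = "{y \<in> V. l y \<in> set K}"
    have "E y z" if "y \<in> ?C" "z \<in> ?C" "y \<noteq> z" for y z
      using that base_graphD(6)[OF bg K(1), of "l y" "l z"] by (intro E) auto
    then have "card {y \<in> V. y = x \<or> E x y} + card ?C \<le> 2 * k"
      using k[unfolded locally_bounded_def, rule_format, OF x(1), of ?C] x K(2) by blast
    moreover have "card {y \<in> V. l y \<in> set (v # nb ! v)} \<le> card {y \<in> V. y = x \<or> E x y}"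
    proof (rule card_mono)
      show "{y \<in> V. l y \<in> set (v # nb ! v)} \<subseteq> {y \<in> V. y = x \<or> E x y}" using E[OF x(1)] x(2) by fastforce
    qed (use V in simp)
    ultimately show "wsum w (v # nb ! v) + wsum w K \<le> 2 * k"
      unfolding w_def wsum_fibre_card[OF V base_graphD(1)[OF bg v]] wsum_fibre_card[OF V base_graphD(4)[OF bg K(1)]]
      by linarith
  qed
  then have col: "multicolourable (\<lambda>u v. v \<in> set (nb ! u)) {..<length nb} k w"
    using gamma_colourable by (simp add: gamma_colourable_def base_colourable_def)
  \<comment> \<open>Every element of \<open>V\<close> has weight 1 and so lies in exactly one colour
    class.\<close>
  have "multicolourable (\<lambda>x y. x \<noteq> y \<and> (l x = l y \<or> l y \<in> set (nb ! l x))) V k (\<lambda>_. 1)"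
    by (rule multicolourable_transfer[OF V col, where p = l]) (use l in \<open>auto simp: w_def\<close>)
  then obtain c where c: "\<forall>i<k. c i \<subseteq> V \<and> (\<forall>x\<in>c i. \<forall>y\<in>c i. \<not> (x \<noteq> y \<and> (l x = l y \<or> l y \<in> set (nb ! l x))))"
    and card: "\<forall>x\<in>V. card {i. i < k \<and> x \<in> c i} = 1"
    unfolding multicolourable_def by blast
  have "\<forall>x\<in>V. \<exists>i. i < k \<and> x \<in> c i"
  proof
    fix x assume "x \<in> V"
    then have one: "card {i. i < k \<and> x \<in> c i} = 1" using card by blast
    show "\<exists>i. i < k \<and> x \<in> c i"
    proof (rule ccontr)
      assume "\<nexists>i. i < k \<and> x \<in> c i"
      then have none: "{i. i < k \<and> x \<in> c i} = {}" by blast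
      show False using one unfolding none by simp
    qed
  qed
  then obtain f where f: "\<forall>x\<in>V. f x < k \<and> x \<in> c (f x)" by metis
  have "f x \<noteq> f y" if "x \<in> V" "y \<in> V" "x \<noteq> y" "l x = l y \<or> l y \<in> set (nb ! l x)" for x y
    using c f that by metis
  then show ?thesis using f by (intro exI[of _ f]) auto
qed

section \<open>Restoring the edges of the matched pairs\<close>

definition fuzzy_pairs :: "(nat \<times> nat) set" where
  "fuzzy_pairs = {(1, 4), (4, 1), (6, 9), (9, 6)}"

text \<open>The label in the graph with split vertices of an element of the cover with original label \<open>i\<close>.\<close>

definition cover_label :: "nat \<Rightarrow> nat" where
  "cover_label i = (if i = 1 then 10 else if i = 4 then 11 else if i = 6 then 12 else if i = 9 then 13 else i)"

text \<open>\<open>s\<close> and \<open>t\<close> say whether an end lies in the cover. Starting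
  from completely joined matched pairs, the split graph loses exactly the edges of these pairs that
  meet the cover.\<close>

lemma fuzzy_nbs_cover_label:
  assumes "i < 10" "j < 10"
  shows "(if s then cover_label i else i) = (if t then cover_label j else j) \<or>
      (if t then cover_label j else j) \<in> set (fuzzy_nbs ! (if s then cover_label i else i)) \<longleftrightarrow>
    (if (i, j) \<in> fuzzy_pairs then \<not> s \<and> \<not> t else i = j \<or> j \<in> set (ico_nbs ! i))"
proof -
  have "\<forall>i\<in>set [0..<10]. \<forall>j\<in>set [0..<10]. \<forall>s\<in>{True, False}. \<forall>t\<in>{True, False}.
     ((if s then cover_label i else i) = (if t then cover_label j else j) \<or>
      (if t then cover_label j else j) \<in> set (fuzzy_nbs ! (if s then cover_label i else i))) =
    (if (i, j) \<in> fuzzy_pairs then \<not> s \<and> \<not> t else i = j \<or> j \<in> set (ico_nbs ! i))"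
    by code_simp
  then show ?thesis using assms by (cases s; cases t) simp_all
qed

text \<open>Koenig's theorem for the bipartite graph of non-edges between \<open>A\<close> and
  \<open>B\<close>, with the two sides of the cover united in one set.\<close>

lemma minimal_nonadjacency_cover:
  assumes "finite A" "finite B"
  shows "\<exists>M C. M \<subseteq> A \<times> B \<and> inj_on fst M \<and> inj_on snd M \<and> (\<forall>(a, b)\<in>M. \<not> E a b) \<and>
    C \<subseteq> A \<union> B \<and> card C \<le> card M \<and> (\<forall>a\<in>A. \<forall>b\<in>B. a \<notin> C \<longrightarrow> b \<notin> C \<longrightarrow> E a b)"
proof -
  define N where "N = {(a, b) \<in> A \<times> B. \<not> E a b}"
  have "finite N" unfolding N_def by (rule finite_subset[of _ "A \<times> B"]) (use assms in auto)
  from koenig[OF this] obtain M C D where M: "M \<subseteq> N" "inj_on fst M" "inj_on snd M"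
    and C: "bip_cover N C D" "card C + card D \<le> card M" by blast
  have cov: "a \<in> C \<or> b \<in> D" if "(a, b) \<in> N" for a b using C(1) that by (auto simp: bip_cover_def)
  have "card (C \<inter> A \<union> D \<inter> B) \<le> card (C \<inter> A) + card (D \<inter> B)" by (rule card_Un_le)
  also have "\<dots> \<le> card C + card D"
    using C(1) by (intro add_mono card_mono) (auto simp: bip_cover_def)
  finally have "card (C \<inter> A \<union> D \<inter> B) \<le> card M" using C(2) by linarith
  moreover have "M \<subseteq> A \<times> B" "\<forall>(a, b)\<in>M. \<not> E a b" using M(1) by (auto simp: N_def)
  moreover have "E a b" if "a \<in> A" "b \<in> B" "a \<notin> C \<inter> A \<union> D \<inter> B" "b \<notin> C \<inter> A \<union> D \<inter> B" for a b
    using cov[of a b] that by (auto simp: N_def)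
  moreover have "C \<inter> A \<union> D \<inter> B \<subseteq> A \<union> B" by blast
  ultimately show ?thesis using M(2,3) by blast
qed

text \<open>Three graphs on \<open>V\<close> are coloured in turn. \<open>E2\<close>, the blow-up of
  the split graph, is contained in \<open>E\<close> and inherits its bound; \<open>E1\<close>
  restores the edges between labels 6 and 9, and \<open>E\<close> those between 1 and 4. Each
  restoration is an application of \<open>recolour_homogeneous_pair\<close> and uses no new
  colour.\<close>

lemma fuzzy_blow_up_colourable:
  assumes V: "finite V" and l: "\<And>x. x \<in> V \<Longrightarrow> l x < 10"
    and sym: "\<And>x y. E x y \<Longrightarrow> x \<noteq> y \<and> E y x"
    and E: "\<And>x y. x \<in> V \<Longrightarrow> y \<in> V \<Longrightarrow> x \<noteq> y \<Longrightarrow> (l x, l y) \<notin> fuzzy_pairs \<Longrightarrow>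
      E x y \<longleftrightarrow> l x = l y \<or> l y \<in> set (ico_nbs ! l x)"
    and k: "locally_bounded V E k"
  shows "\<exists>f. f ` V \<subseteq> {..<k} \<and> (\<forall>x\<in>V. \<forall>y\<in>V. E x y \<longrightarrow> f x \<noteq> f y)"
proof -
  let ?L = "\<lambda>i. {x \<in> V. l x = i}"
  have fin: "finite (?L i)" for i using V by simp
  obtain M1 C1 where 1: "M1 \<subseteq> ?L 1 \<times> ?L 4" "inj_on fst M1" "inj_on snd M1" "\<forall>(a, b)\<in>M1. \<not> E a b"
      "C1 \<subseteq> ?L 1 \<union> ?L 4" "card C1 \<le> card M1" "\<forall>a\<in>?L 1. \<forall>b\<in>?L 4. a \<notin> C1 \<longrightarrow> b \<notin> C1 \<longrightarrow> E a b"
    using minimal_nonadjacency_cover[OF fin fin, of 1 4 E] by blast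
  obtain M2 C2 where 2: "M2 \<subseteq> ?L 6 \<times> ?L 9" "inj_on fst M2" "inj_on snd M2" "\<forall>(a, b)\<in>M2. \<not> E a b"
      "C2 \<subseteq> ?L 6 \<union> ?L 9" "card C2 \<le> card M2" "\<forall>a\<in>?L 6. \<forall>b\<in>?L 9. a \<notin> C2 \<longrightarrow> b \<notin> C2 \<longrightarrow> E a b"
    using minimal_nonadjacency_cover[OF fin fin, of 6 9 E] by blast
  define U where "U = C1 \<union> C2"
  define m where "m x = (if x \<in> U then cover_label (l x) else l x)" for x
  define E2 where "E2 x y \<longleftrightarrow> x \<noteq> y \<and> (if (l x, l y) \<in> fuzzy_pairs then x \<notin> U \<and> y \<notin> U else l x = l y \<or> l y \<in> set (ico_nbs ! l x))" for x y
  define E1 where "E1 x y \<longleftrightarrow> (if (l x, l y) \<in> {(6, 9), (9, 6)} then E x y else E2 x y)" for x y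
  have m: "m x = m y \<or> m y \<in> set (fuzzy_nbs ! m x) \<longleftrightarrow>
      (if (l x, l y) \<in> fuzzy_pairs then x \<notin> U \<and> y \<notin> U else l x = l y \<or> l y \<in> set (ico_nbs ! l x))"
    if "x \<in> V" "y \<in> V" for x y
    using fuzzy_nbs_cover_label[OF l[OF that(1)] l[OF that(2)], of "x \<in> U" "y \<in> U"] unfolding m_def by simp
  have U: "E x y" if "x \<in> V" "y \<in> V" "(l x, l y) \<in> fuzzy_pairs" "x \<notin> U" "y \<notin> U" for x y
    using that 1(7) 2(7) sym unfolding fuzzy_pairs_def U_def by auto
  have "\<exists>f. f ` V \<subseteq> {..<k} \<and> (\<forall>x\<in>V. \<forall>y\<in>V. x \<noteq> y \<longrightarrow> m x = m y \<or> m y \<in> set (fuzzy_nbs ! m x) \<longrightarrow> f x \<noteq> f y)"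
  proof (rule blow_up_colourable[OF base_graph_fuzzy gamma_colourable_fuzzy V _ _ k])
    show "m x < length fuzzy_nbs" if "x \<in> V" for x
      using l[OF that] by (auto simp: m_def cover_label_def length_simps)
    show "E x y" if "x \<in> V" "y \<in> V" "x \<noteq> y" "m x = m y \<or> m y \<in> set (fuzzy_nbs ! m x)" for x y
      using that m[OF that(1,2)] U[OF that(1,2)] E[OF that(1,2)] by (auto split: if_splits)
  qed
  then obtain f2 where f2: "f2 ` V \<subseteq> {..<k}" "\<forall>x\<in>V. \<forall>y\<in>V. E2 x y \<longrightarrow> f2 x \<noteq> f2 y"
    unfolding E2_def using m by metis
  have E1_sym: "x \<noteq> y \<and> E1 y x" if "x \<in> V" "y \<in> V" "E1 x y" for x y
  proof (cases "(l x, l y) \<in> fuzzy_pairs")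
    case True
    then show ?thesis using that(3) sym by (auto simp: E1_def E2_def fuzzy_pairs_def)
  next
    case False
    then have "E1 x y \<longleftrightarrow> E x y" "E1 y x \<longleftrightarrow> E y x" if "x \<noteq> y"
      using that E \<open>x \<in> V\<close> \<open>y \<in> V\<close> by (auto simp: E1_def E2_def fuzzy_pairs_def)
    moreover have "x \<noteq> y" using that(3) sym by (auto simp: E1_def E2_def split: if_splits)
    ultimately show ?thesis using that(3) sym by blast
  qed
  have "\<exists>f1. f1 ` V \<subseteq> f2 ` V \<and> (\<forall>x\<in>V. \<forall>y\<in>V. E1 x y \<longrightarrow> f1 x \<noteq> f1 y)"
  proof (rule recolour_homogeneous_pair[where A = "?L 6" and B = "?L 9" and E' = E2 and M = M2 and C = C2])
    show "E2 x a'" if "x \<in> V - (?L 6 \<union> ?L 9)" "a \<in> ?L 6 \<and> a' \<in> ?L 6 \<or> a \<in> ?L 9 \<and> a' \<in> ?L 9" "E1 x a" for x a a'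
      using that by (auto simp: E1_def E2_def fuzzy_pairs_def)
    show "E2 x y" if "x \<in> V - (?L 6 \<union> ?L 9)" "y \<in> V - (?L 6 \<union> ?L 9)" "E1 x y" for x y
      using that by (auto simp: E1_def)
    show "\<not> E1 a b" if "(a, b) \<in> M2" for a b using 2(1,4) that by (auto simp: E1_def)
    show "E2 x y" if "x \<in> ?L 6 \<and> y \<in> ?L 6 \<or> x \<in> ?L 9 \<and> y \<in> ?L 9" "x \<noteq> y" for x y
      using that by (auto simp: E2_def fuzzy_pairs_def)
    \<comment> \<open>\<open>C1\<close> has only the labels 1 and 4, so on the labels 6 and 9 the
      set \<open>U\<close> is just \<open>C2\<close>.\<close>
    show "E2 a b" if "a \<in> ?L 6" "b \<in> ?L 9" "a \<notin> C2" "b \<notin> C2" for a b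
      using that 1(5) by (auto simp: E2_def fuzzy_pairs_def U_def)
    show "finite C2" using 2(5) fin by (meson finite_UnI finite_subset)
  qed (use V 2 f2(2) E1_sym in auto)
  then obtain f1 where f1: "f1 ` V \<subseteq> f2 ` V" "\<forall>x\<in>V. \<forall>y\<in>V. E1 x y \<longrightarrow> f1 x \<noteq> f1 y" by blast
  have EE1: "E x y \<longleftrightarrow> E1 x y" if "x \<in> V" "y \<in> V" "(l x, l y) \<notin> {(1, 4), (4, 1)}" for x y
  proof (cases "x = y")
    case True
    then show ?thesis using sym[of x x] by (auto simp: E1_def E2_def)
  next
    case False
    then show ?thesis using E[OF that(1,2)] that(3) by (auto simp: E1_def E2_def fuzzy_pairs_def)
  qed
  have "\<exists>f. f ` V \<subseteq> f1 ` V \<and> (\<forall>x\<in>V. \<forall>y\<in>V. E x y \<longrightarrow> f x \<noteq> f y)"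
  proof (rule recolour_homogeneous_pair[where A = "?L 1" and B = "?L 4" and E' = E1 and M = M1 and C = C1])
    show "E1 x a'" if "x \<in> V - (?L 1 \<union> ?L 4)" "a \<in> ?L 1 \<and> a' \<in> ?L 1 \<or> a \<in> ?L 4 \<and> a' \<in> ?L 4" "E x a" for x a a'
    proof -
      have "E1 x a" using that EE1[of x a] by auto
      then show ?thesis using that(1,2) by (auto simp: E1_def E2_def fuzzy_pairs_def)
    qed
    show "E1 x y" if "x \<in> V - (?L 1 \<union> ?L 4)" "y \<in> V - (?L 1 \<union> ?L 4)" "E x y" for x y
      using that EE1[of x y] by auto
    show "\<not> E a b" if "(a, b) \<in> M1" for a b using 1(4) that by auto
    show "E1 x y" if "x \<in> ?L 1 \<and> y \<in> ?L 1 \<or> x \<in> ?L 4 \<and> y \<in> ?L 4" "x \<noteq> y" for x y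
      using that by (auto simp: E1_def E2_def fuzzy_pairs_def)
    show "E1 a b" if "a \<in> ?L 1" "b \<in> ?L 4" "a \<notin> C1" "b \<notin> C1" for a b
      using that 2(5) by (auto simp: E1_def E2_def fuzzy_pairs_def U_def)
    show "finite C1" using 1(5) fin by (meson finite_UnI finite_subset)
  qed (use V 1 f1(2) sym in auto)
  then obtain f where f: "f ` V \<subseteq> f1 ` V" "\<forall>x\<in>V. \<forall>y\<in>V. E x y \<longrightarrow> f x \<noteq> f y" by blast
  have "f ` V \<subseteq> {..<k}" by (rule subset_trans[OF f(1) subset_trans[OF f1(1) f2(1)]])
  then show ?thesis using f(2) by (intro exI[of _ f] conjI)
qed

section \<open>From thickenings to labelled blow-ups\<close>

lemma G0_edge_iff:
  assumes "i < 12" "j < 12"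
  shows "{i, j} \<in> edges G0 \<longleftrightarrow> j \<in> set (ico_nbs ! i)"
proof -
  \<comment> \<open>Set comprehensions become bounded quantifiers, which evaluation can decide for
    all pairs.\<close>
  have edge: "{i, j} \<in> edges G0 \<longleftrightarrow>
      (\<exists>a\<in>set [1..<11]. \<exists>k\<in>{1, 2}. i = a \<and> j = cyc a k \<or> j = a \<and> i = cyc a k) \<or>
      (\<exists>a\<in>{1, 3, 5, 7, 9}. i = 0 \<and> j = a \<or> j = 0 \<and> i = a) \<or>
      (\<exists>a\<in>{2, 4, 6, 8, 10}. i = 11 \<and> j = a \<or> j = 11 \<and> i = a)" for i j
  proof -
    have 1: "{i, j} \<in> {{a, cyc a k} | a k. a \<in> {1..10} \<and> k \<in> {1, 2}} \<longleftrightarrow>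
        (\<exists>a\<in>set [1..<11]. \<exists>k\<in>{1, 2}. i = a \<and> j = cyc a k \<or> j = a \<and> i = cyc a k)"
    proof -
      have "set [1..<11] = {1..10::nat}" by auto
      then show ?thesis unfolding doubleton_eq_iff mem_Collect_eq Bex_def by metis
    qed
    have 2: "{i, j} \<in> {{b, a} | a. a \<in> S} \<longleftrightarrow> (\<exists>a\<in>S. i = b \<and> j = a \<or> j = b \<and> i = a)" for b S
      unfolding doubleton_eq_iff mem_Collect_eq Bex_def by metis
    show ?thesis
      unfolding G0_def sgraph.select_convs Un_iff 1 2 disj_assoc ..
  qed
  have nbs: "\<forall>i\<in>set [0..<12]. \<forall>j\<in>set [0..<12]. j \<in> set (ico_nbs ! i) \<longleftrightarrow>
      (\<exists>a\<in>set [1..<11]. \<exists>k\<in>{1, 2}. i = a \<and> j = cyc a k \<or> j = a \<and> i = cyc a k) \<or>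
      (\<exists>a\<in>{1, 3, 5, 7, 9}. i = 0 \<and> j = a \<or> j = 0 \<and> i = a) \<or>
      (\<exists>a\<in>{2, 4, 6, 8, 10}. i = 11 \<and> j = a \<or> j = 11 \<and> i = a)"
    by code_simp
  have mem: "i \<in> set [0..<12]" "j \<in> set [0..<12]" using assms by simp_all
  show ?thesis unfolding edge by (rule bspec[OF bspec[OF nbs mem(1)] mem(2), symmetric])
qed

lemma simple_graph_G0: "simple_graph G0" and verts_G0: "verts G0 = {0..11}"
proof -
  show V: "verts G0 = {0..11}" by (simp add: G0_def)
  have "e \<in> [{0..11}]\<^bsup>2\<^esup>" if e: "e \<in> edges G0" for e
  proof -
    have cyc: "cyc i k < 12" for i k using mod_less_divisor[of 10 "i + k - 1"] unfolding cyc_def by linarith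
    have "\<exists>i j. e = {i, j} \<and> i < 12 \<and> j < 12"
    proof -
      consider i k where "e = {i, cyc i k}" "i \<in> {1..10}" | a where "e = {0, a}" "a \<in> {1, 3, 5, 7, 9}"
        | a where "e = {11, a}" "a \<in> {2, 4, 6, 8, 10}"
        using e unfolding G0_def by auto
      then show ?thesis
      proof cases
        case (1 i k)
        then show ?thesis using cyc[of i k] by - (rule exI[of _ i], rule exI[of _ "cyc i k"], simp)
      next
        case (2 a)
        then show ?thesis by - (rule exI[of _ 0], rule exI[of _ a], auto)
      next
        case (3 a)
        then show ?thesis by - (rule exI[of _ 11], rule exI[of _ a], auto)
      qed
    qed
    then obtain i j where ij: "e = {i, j}" "i < 12" "j < 12" by blast
    then have "j \<in> set (ico_nbs ! i)" using e G0_edge_iff by blast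
    then have "i \<noteq> j" using base_graphD(1)[OF base_graph_ico, of i] ij(2) by (auto simp: length_simps)
    then show ?thesis using ij by (auto simp: nsets_def)
  qed
  then show "simple_graph G0" unfolding simple_graph_def V by auto
qed

lemma G1_eq: "verts G1 = {0..10}" "edges G1 = {e \<in> edges G0. e \<subseteq> {0..10}}"
proof -
  have "verts G0 - {11} = {0..10}" by (auto simp: verts_G0)
  then show "verts G1 = {0..10}" "edges G1 = {e \<in> edges G0. e \<subseteq> {0..10}}"
    by (simp_all add: G1_def delete_vertex_def induced_def)
qed

lemma G2_eq: "verts G2 = {0..9}" "edges G2 = {e \<in> edges G0. e \<subseteq> {0..9}}"
proof -
  have "verts G1 - {10} = {0..9}" by (auto simp: G1_eq(1))
  moreover have "{0..9} \<subseteq> {0..10::nat}" by simp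
  ultimately show "verts G2 = {0..9}" "edges G2 = {e \<in> edges G0. e \<subseteq> {0..9}}"
    using subset_trans unfolding G2_def delete_vertex_def induced_def G1_eq(2) by auto
qed

text \<open>\<open>l x\<close> is the vertex whose clique contains \<open>x\<close>. Outside
  \<open>M\<close> the labels determine adjacency, because all edges removed for a matching edge
  join the two cliques of its ends.\<close>

lemma thickening_labels:
  assumes T: "thickening K M H" and simple: "simple_graph K"
  obtains l where "\<And>x. x \<in> verts H \<Longrightarrow> l x \<in> verts K"
    "\<And>x y. x \<in> verts H \<Longrightarrow> y \<in> verts H \<Longrightarrow> x \<noteq> y \<Longrightarrow> {l x, l y} \<notin> M \<Longrightarrow>
      {x, y} \<in> edges H \<longleftrightarrow> l x = l y \<or> {l x, l y} \<in> edges K"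
proof -
  obtain I R where disj: "disjoint_family_on I (verts K)"
    and R: "\<forall>u v. {u, v} \<in> M \<longrightarrow> R {u, v} \<noteq> {} \<and> R {u, v} \<subset> edges_between (I u) (I v)"
    and V: "verts H = (\<Union>v \<in> verts K. I v)"
    and E: "edges H = ((\<Union>v \<in> verts K. [I v]\<^bsup>2\<^esup>) \<union> \<Union>{edges_between (I u) (I v) | u v. {u, v} \<in> edges K})
                  - (\<Union>e \<in> M. R e)"
    using T unfolding thickening_def by (elim conjE exE) (rule that; assumption)
  have M: "M \<subseteq> edges K" using T by (simp add: thickening_def matching_def)
  have K: "u \<in> verts K \<and> v \<in> verts K \<and> u \<noteq> v" if "{u, v} \<in> edges K" for u v
    using that simple by (auto simp: simple_graph_def nsets_def card_2_iff doubleton_eq_iff)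
  define l where "l x = (THE v. v \<in> verts K \<and> x \<in> I v)" for x
  have l_eq: "l x = v" if "v \<in> verts K" "x \<in> I v" for x v
    unfolding l_def by (rule the_equality) (use that disj in \<open>auto simp: disjoint_family_on_def\<close>)
  have l: "l x \<in> verts K \<and> x \<in> I (l x)" if "x \<in> verts H" for x
    using that l_eq V by fastforce
  have between: "{l x, l y} = {u, v}" if "{x, y} \<in> edges_between (I u) (I v)" "u \<in> verts K" "v \<in> verts K" for x y u v
    using that l_eq unfolding edges_between_def by (auto simp: doubleton_eq_iff)
  have "{x, y} \<in> edges H \<longleftrightarrow> l x = l y \<or> {l x, l y} \<in> edges K"
    if xy: "x \<in> verts H" "y \<in> verts H" "x \<noteq> y" "{l x, l y} \<notin> M" for x y
  proof -
    have "{x, y} \<notin> R e" if e: "e \<in> M" for e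
    proof
      assume "{x, y} \<in> R e"
      obtain u v where uv: "e = {u, v}" using e M simple by (auto simp: simple_graph_def nsets_def card_2_iff)
      then have "{x, y} \<in> edges_between (I u) (I v)" using R e \<open>{x, y} \<in> R e\<close> by blast
      then have "{l x, l y} = e" using between K[of u v] e M uv by blast
      then show False using xy(4) e by blast
    qed
    then have 1: "{x, y} \<in> edges H \<longleftrightarrow> {x, y} \<in> (\<Union>v \<in> verts K. [I v]\<^bsup>2\<^esup>) \<or>
        {x, y} \<in> \<Union>{edges_between (I u) (I v) | u v. {u, v} \<in> edges K}"
      unfolding E by blast
    have 2: "{x, y} \<in> (\<Union>v \<in> verts K. [I v]\<^bsup>2\<^esup>) \<longleftrightarrow> l x = l y"
    proof
      assume "{x, y} \<in> (\<Union>v \<in> verts K. [I v]\<^bsup>2\<^esup>)"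
      then obtain v where "v \<in> verts K" "x \<in> I v" "y \<in> I v" by (auto simp: nsets_def)
      then show "l x = l y" using l_eq by metis
    next
      assume "l x = l y"
      then have "{x, y} \<in> [I (l x)]\<^bsup>2\<^esup>" using l[OF xy(1)] l[OF xy(2)] xy(3) by (simp add: nsets_def)
      then show "{x, y} \<in> (\<Union>v \<in> verts K. [I v]\<^bsup>2\<^esup>)" using l[OF xy(1)] by blast
    qed
    have 3: "{x, y} \<in> \<Union>{edges_between (I u) (I v) | u v. {u, v} \<in> edges K} \<longleftrightarrow> {l x, l y} \<in> edges K"
    proof
      assume "{x, y} \<in> \<Union>{edges_between (I u) (I v) | u v. {u, v} \<in> edges K}"
      then obtain u v where uv: "{u, v} \<in> edges K" "{x, y} \<in> edges_between (I u) (I v)" by blast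
      then have "{l x, l y} = {u, v}" using between K by blast
      then show "{l x, l y} \<in> edges K" using uv(1) by simp
    next
      assume "{l x, l y} \<in> edges K"
      moreover have "{x, y} \<in> edges_between (I (l x)) (I (l y))"
        using l[OF xy(1)] l[OF xy(2)] unfolding edges_between_def by blast
      ultimately show "{x, y} \<in> \<Union>{edges_between (I u) (I v) | u v. {u, v} \<in> edges K}" by blast
    qed
    show ?thesis using 1 2 3 by blast
  qed
  then show ?thesis using that[of l] l by blast
qed

text \<open>\<open>C\<close> takes part in the maximum defining the clique number at
  \<open>x\<close>, the closed neighbourhood exceeds the degree by \<open>x\<close> itself, and
  doubling clears the ceiling.\<close>

lemma locally_bounded_gamma_ell:
  assumes simple: "simple_graph G"
  shows "locally_bounded (verts G) (\<lambda>x y. {x, y} \<in> edges G) (nat (gamma_ell G))"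
  unfolding locally_bounded_def
proof (intro ballI allI impI)
  fix x C assume x: "x \<in> verts G" and C: "C \<subseteq> verts G" "x \<in> C" "\<forall>y\<in>C. \<forall>z\<in>C. y \<noteq> z \<longrightarrow> {y, z} \<in> edges G"
  have fin: "finite (verts G)" using simple by (simp add: simple_graph_def)
  let ?N = "{u \<in> verts G. {u, x} \<in> edges G}"
  have nin: "x \<notin> ?N" using simple by (auto simp: simple_graph_def nsets_def)
  have "{y \<in> verts G. y = x \<or> {x, y} \<in> edges G} = insert x ?N"
    using x by (auto simp: insert_commute)
  then have deg: "card {y \<in> verts G. y = x \<or> {x, y} \<in> edges G} = vdegree G x + 1"
    unfolding vdegree_def using fin nin by (simp only: card_insert_disjoint finite_Collect_conjI) simp
  have "card C \<le> vclique_number G x"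
    unfolding vclique_number_def
  proof (rule Max_ge)
    show "finite (card ` {K. K \<subseteq> verts G \<and> clique K (edges G) \<and> x \<in> K})"
      by (rule finite_imageI, rule finite_subset[of _ "Pow (verts G)"]) (use fin in auto)
    show "card C \<in> card ` {K. K \<subseteq> verts G \<and> clique K (edges G) \<and> x \<in> K}"
      using C by (intro imageI) (auto simp: clique_def)
  qed
  moreover have "vgamma_ell G x \<le> gamma_ell G"
    unfolding gamma_ell_def using fin x by (intro Max_ge) auto
  then have "(real (vdegree G x) + 1 + real (vclique_number G x)) / 2 \<le> real_of_int (gamma_ell G)"
    unfolding vgamma_ell_def by (simp add: ceiling_le_iff)
  then have "real (vdegree G x) + 1 + real (vclique_number G x) \<le> 2 * real_of_int (gamma_ell G)" by simp
  ultimately show "card {y \<in> verts G. y = x \<or> {x, y} \<in> edges G} + card C \<le> 2 * nat (gamma_ell G)"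
    unfolding deg by linarith
qed

lemma chromatic_number_le:
  assumes "f ` verts G \<subseteq> {..<k}" "\<forall>x\<in>verts G. \<forall>y\<in>verts G. {x, y} \<in> edges G \<longrightarrow> f x \<noteq> f y"
  shows "chromatic_number G \<le> k"
  unfolding chromatic_number_def by (rule Least_le) (use assms in \<open>auto simp: proper_colouring_def\<close>)

theorem theorem6p2:
  fixes G H :: "'a sgraph"
  assumes "icosahedral_thickening H"
    and "is_induced_subgraph G H"
  shows "int (chromatic_number G) \<le> gamma_ell G"
proof -
  note G0 = simple_graph_G0 verts_G0
  have G12: "simple_graph G1" "simple_graph G2"
    using G0(1) by (auto simp: simple_graph_def G1_eq G2_eq nsets_def subset_iff)
  have GM: "simple_graph (add_edges G2 M)" if "M \<subseteq> {{1, 4}, {6, 9}}" for M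
  proof -
    have "{{1, 4}, {6, 9}} \<subseteq> [verts G2]\<^bsup>2\<^esup>" by (auto simp: nsets_def G2_eq card_insert_if)
    then show ?thesis using G12(2) that by (auto simp: simple_graph_def add_edges_def)
  qed
  obtain W where W: "W \<subseteq> verts H" "verts G = W" "edges G = {e \<in> edges H. e \<subseteq> W}"
    using assms(2) by (auto simp: is_induced_subgraph_def induced_def)
  have edge: "{x, y} \<in> edges G \<longleftrightarrow> {x, y} \<in> edges H" if "x \<in> W" "y \<in> W" for x y
    using that W(3) by simp
  have "\<exists>(K :: nat sgraph) M. simple_graph K \<and> thickening K M H"
    using assms(1) unfolding icosahedral_thickening_def proper_thickening_def
  proof (elim disjE exE conjE)
    show ?thesis if "thickening G0 {} H" using that G0(1) by blast
    show ?thesis if "thickening G1 {} H" using that G12(1) by blast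
    show ?thesis if "M \<subseteq> {{1, 4}, {6, 9}}" "thickening (add_edges G2 M) M H" for M using that(2) GM[OF that(1)] by blast
  qed
  then have "simple_graph H" using thickening_simple_graph by blast
  then have H: "finite (verts H)" "edges H \<subseteq> [verts H]\<^bsup>2\<^esup>" by (simp_all add: simple_graph_def)
  have simple: "simple_graph G"
    unfolding simple_graph_def W(2,3) using finite_subset[OF W(1) H(1)] H(2) by (auto simp: nsets_def)
  then have irrefl: "x \<noteq> y" if "{x, y} \<in> edges G" for x y
    using that unfolding simple_graph_def nsets_def by auto
  have fin: "finite W" using simple W(2) by (simp add: simple_graph_def)
  let ?k = "nat (gamma_ell G)"
  note k = locally_bounded_gamma_ell[OF simple, unfolded W(2)]
  have "\<exists>f. f ` W \<subseteq> {..<?k} \<and> (\<forall>x\<in>W. \<forall>y\<in>W. {x, y} \<in> edges G \<longrightarrow> f x \<noteq> f y)"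
  proof -
    consider K where "K \<in> {G0, G1}" "thickening K {} H"
      | M where "M \<subseteq> {{1, 4}, {6, 9}}" "thickening (add_edges G2 M) M H"
      using assms(1) by (auto simp: icosahedral_thickening_def proper_thickening_def)
    then show ?thesis
    proof cases
      case 1
      have K: "K = G0 \<or> K = G1" using 1(1) by simp
      have K_simple: "simple_graph K" using K G0(1) G12(1) by blast
      have K_verts: "verts K \<subseteq> {0..11}" using K by (elim disjE) (simp_all add: G0(2) G1_eq(1))
      have K_edges: "{i, j} \<in> edges K \<longleftrightarrow> {i, j} \<in> edges G0" if "i \<in> verts K" "j \<in> verts K" for i j
        using K that by (elim disjE) (simp_all add: G1_eq)
      obtain l where l: "\<And>x. x \<in> verts H \<Longrightarrow> l x \<in> verts K"
        "\<And>x y. x \<in> verts H \<Longrightarrow> y \<in> verts H \<Longrightarrow> x \<noteq> y \<Longrightarrow> {l x, l y} \<notin> {} \<Longrightarrow>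
          {x, y} \<in> edges H \<longleftrightarrow> l x = l y \<or> {l x, l y} \<in> edges K"
        using thickening_labels[OF 1(2) K_simple] by blast
      have lK: "l x \<in> verts K" if "x \<in> W" for x using l(1) W(1) that by blast
      then have l12: "l x < 12" if "x \<in> W" for x using subsetD[OF K_verts lK[OF that]] by simp
      \<comment> \<open>No edges are removed, so labels alone decide adjacency. For
        \<open>G1\<close> the label 11 does not occur, which is merely an empty class.\<close>
      have E: "{x, y} \<in> edges G \<longleftrightarrow> l x = l y \<or> l y \<in> set (ico_nbs ! l x)" if xy: "x \<in> W" "y \<in> W" "x \<noteq> y" for x y
        using edge[OF xy(1,2)] l(2)[OF subsetD[OF W(1) xy(1)] subsetD[OF W(1) xy(2)] xy(3)]
          K_edges[OF lK lK, OF xy(1,2)] G0_edge_iff[OF l12 l12, OF xy(1,2)] by simp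
      have "\<exists>f. f ` W \<subseteq> {..<?k} \<and> (\<forall>x\<in>W. \<forall>y\<in>W. x \<noteq> y \<longrightarrow> l x = l y \<or> l y \<in> set (ico_nbs ! l x) \<longrightarrow> f x \<noteq> f y)"
        by (rule blow_up_colourable[OF base_graph_ico gamma_colourable_ico fin _ _ k]) (use l12 E in \<open>auto simp: length_simps\<close>)
      then show ?thesis using E irrefl by metis
    next
      case 2
      obtain l where l: "\<And>x. x \<in> verts H \<Longrightarrow> l x \<in> verts (add_edges G2 M)"
        "\<And>x y. x \<in> verts H \<Longrightarrow> y \<in> verts H \<Longrightarrow> x \<noteq> y \<Longrightarrow> {l x, l y} \<notin> M \<Longrightarrow>
          {x, y} \<in> edges H \<longleftrightarrow> l x = l y \<or> {l x, l y} \<in> edges (add_edges G2 M)"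
        using thickening_labels[OF 2(2) GM[OF 2(1)]] by blast
      have l10: "l x \<in> {0..9}" if "x \<in> W" for x
        using l(1)[OF subsetD[OF W(1) that]] by (simp add: add_edges_def G2_eq(1))
      \<comment> \<open>The rule used here leaves adjacency free on \<open>fuzzy_pairs\<close>. This
        treats all choices of \<open>M\<close> together: a pair outside \<open>M\<close> simply has
        no edges.\<close>
      show ?thesis
      proof (rule fuzzy_blow_up_colourable[OF fin _ _ _ k])
        show "l x < 10" if "x \<in> W" for x using l10[OF that] by simp
        show "x \<noteq> y \<and> {y, x} \<in> edges G" if "{x, y} \<in> edges G" for x y
          using irrefl that by (auto simp: insert_commute)
        show "{x, y} \<in> edges G \<longleftrightarrow> l x = l y \<or> l y \<in> set (ico_nbs ! l x)"
          if xy: "x \<in> W" "y \<in> W" "x \<noteq> y" "(l x, l y) \<notin> fuzzy_pairs" for x y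
        proof -
          have "{l x, l y} \<noteq> {1, 4}" "{l x, l y} \<noteq> {6, 9}"
            using xy(4) by (auto simp: fuzzy_pairs_def doubleton_eq_iff)
          then have M: "{l x, l y} \<notin> M" using 2(1) by blast
          have "{l x, l y} \<in> edges (add_edges G2 M) \<longleftrightarrow> {l x, l y} \<in> edges G0"
            using M l10[OF xy(1)] l10[OF xy(2)] by (simp add: add_edges_def G2_eq(2))
          then show ?thesis
            using edge[OF xy(1,2)] l(2)[OF subsetD[OF W(1) xy(1)] subsetD[OF W(1) xy(2)] xy(3) M]
              G0_edge_iff[of "l x" "l y"] l10[OF xy(1)] l10[OF xy(2)] by simp
        qed
      qed
    qed
  qed
  then have "chromatic_number G \<le> ?k" using chromatic_number_le W(2) by metis
  \<comment> \<open>The 0 inserted in \<open>gamma_ell\<close> gives this for the empty graph too,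
    so \<open>nat\<close> changes nothing.\<close>
  moreover have "0 \<le> gamma_ell G"
    unfolding gamma_ell_def using fin W(2) by (intro Max_ge) auto
  ultimately show ?thesis by linarith
qed

end
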